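(* Let $p$ be a prime with $p\equiv 1\pmod 3$, let $q$ be an odd prime such that $p$ is a quadratic residue modulo $q$, and let $Q_1,\dots,Q_{14},S_1,\dots,S_{14}$ be the quadratic residue codes over $\mathcal{R}$ of length $q$ defined below. Then: (i) $Q_i$ is equivalent to $Q_{i+4}$ and $S_i$ is equivalent to $S_{i+4}$ for $i=1,2,3,4$; (ii) $Q_j$ is equivalent to $Q_{j+3}$ and $S_j$ is equivalent to $S_{j+3}$ for $j=9,10,11$; (iii) for $i=1,2,3,4$: $Q_i\cap Q_{i+4}=\langle\frac1q h\rangle$, $Q_i+Q_{i+4}=\mathcal{R}_q$, $S_i\cap S_{i+4}=\{0\}$, $S_i+S_{i+4}=\langle 1-\frac1q h\rangle$; (iv) for $k=9,10,11$: $Q_k\cap Q_{k+3}=\langle\frac1q h\rangle$, $Q_k+Q_{k+3}=\mathcal{R}_q$, $S_k\cap S_{k+3}=\{0\}$, $S_k+S_{k+3}=\langle1-\frac1q h\rangle$; (v) $S_i\cap\langle\frac1q h\rangle=\{0\}$ and $S_i+\langle\frac1q h\rangle=Q_i$ for $i=1,\dots,14$; (vi) $|Q_i|=p^{2(q+1)}$ and $|S_i|=p^{2(q-1)}$ for $i=1,\dots,14$.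
   Context: $\mathcal{R}=\mathbb{F}_p+u\mathbb{F}_p+u^2\mathbb{F}_p+u^3\mathbb{F}_p$ with $u^4=u$; $\mathcal{R}_q=\mathcal{R}[x]/\langle x^q-1\rangle$; cyclic codes of length $q$ are ideals of $\mathcal{R}_q$ and $\langle\cdot\rangle$ denotes the ideal generated. $\xi\in\mathbb{F}_p$ is a primitive cube root of unity; $\eta_1=1-u^3$, $\eta_2=3^{-1}(u+u^2+u^3)$, $\eta_3=3^{-1}(\xi u+\xi^2u^2+u^3)$, $\eta_4=3^{-1}(\xi^2u+\xi u^2+u^3)$. With $Q_q,N_q$ the quadratic residues/non-residues mod $q$, $j_1=\sum_{i\in Q_q}x^i$, $j_2=\sum_{i\in N_q}x^i$, $h=1+j_1+j_2$, $\alpha$ a primitive $q$-th root of unity over $\mathbb{F}_p$, $\chi$ the Legendre symbol mod $q$, $\theta=\sum_{i=1}^{q-1}\chi(i)\alpha^i\in\mathbb{F}_p$: $e_1=\frac12(1+\frac1q)+\frac12(\frac1q-\frac1\theta)j_1+\frac12(\frac1q+\frac1\theta)j_2$, $e_2=\frac12(1+\frac1q)+\frac12(\frac1q-\frac1\theta)j_2+\frac12(\frac1q+\frac1\theta)j_1$, $\tilde e_1=\frac12(1-\frac1q)-\frac12(\frac1q+\frac1\theta)j_1-\frac12(\frac1q-\frac1\theta)j_2$, $\tilde e_2=\frac12(1-\frac1q)-\frac12(\frac1q+\frac1\theta)j_2-\frac12(\frac1q-\frac1\theta)j_1$. For $i=1,2,3,4$: $Q_i=\langle(1-\eta_i)e_1+\eta_ie_2\rangle$,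 $Q_{i+4}=\langle\eta_ie_1+(1-\eta_i)e_2\rangle$, $S_i=\langle(1-\eta_i)\tilde e_1+\eta_i\tilde e_2\rangle$, $S_{i+4}=\langle\eta_i\tilde e_1+(1-\eta_i)\tilde e_2\rangle$. For $k=9,10,11$ with $(i,j)=(1,2),(1,3),(1,4)$ respectively: $Q_k=\langle(\eta_i+\eta_j)e_1+(1-\eta_i-\eta_j)e_2\rangle$, $Q_{k+3}=\langle(\eta_i+\eta_j)e_2+(1-\eta_i-\eta_j)e_1\rangle$, $S_k=\langle(\eta_i+\eta_j)\tilde e_1+(1-\eta_i-\eta_j)\tilde e_2\rangle$, $S_{k+3}=\langle(\eta_i+\eta_j)\tilde e_2+(1-\eta_i-\eta_j)\tilde e_1\rangle$. Two codes are equivalent if one is obtained from the other by multiplying coordinates by units of $\mathcal{R}$ and permuting coordinates. *)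

theory Defs
  imports
    Berlekamp_Zassenhaus.Finite_Field
    "HOL-Algebra.Algebraic_Closure_Type"
    "HOL-Library.Set_Algebras"
    "HOL-Combinatorics.Permutations"
begin

text \<open>
  The field \<open>F\<^sub>p\<close> is \<^typ>\<open>'p mod_ring\<close> with \<open>p = CARD('p)\<close> prime (class \<^class>\<open>prime_card\<close>).
\<close>

section \<open>The ring \<open>R = F\<^sub>p[u]/(u\<^sup>4 - u)\<close>\<close>

definition R_modulus :: "'p::prime_card mod_ring poly"
  where "R_modulus = Polynomial.monom 1 4 - Polynomial.monom 1 1"

definition R_eq :: "'p::prime_card mod_ring poly \<Rightarrow> 'p mod_ring poly \<Rightarrow> bool"
  where "R_eq f g \<longleftrightarrow> R_modulus dvd f - g"

lemma equivp_dvd_diff: "equivp (\<lambda>f g :: 'a::comm_ring_1. m dvd f - g)"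
proof (rule equivpI)
  show "reflp (\<lambda>f g. m dvd f - g)"
    by (simp add: reflp_def)
  show "symp (\<lambda>f g. m dvd f - g)"
    unfolding symp_def by (metis dvd_minus_iff minus_diff_eq)
  show "transp (\<lambda>f g. m dvd f - g)"
  proof (rule transpI)
    fix a b c assume "m dvd a - b" "m dvd b - c"
    then have "m dvd (a - b) + (b - c)" by (rule dvd_add)
    then show "m dvd a - c" by simp
  qed
qed

lemma dvd_diff_add:
  fixes m :: "'a::comm_ring_1"
  assumes "m dvd a - b" "m dvd c - d" shows "m dvd (a + c) - (b + d)"
  using dvd_add[OF assms] by (simp add: algebra_simps)

lemma dvd_diff_diff:
  fixes m :: "'a::comm_ring_1"
  assumes "m dvd a - b" "m dvd c - d" shows "m dvd (a - c) - (b - d)"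
  using dvd_diff[OF assms] by (simp add: algebra_simps)

lemma dvd_diff_uminus:
  fixes m :: "'a::comm_ring_1"
  assumes "m dvd a - b" shows "m dvd (- a) - (- b)"
  using dvd_diff_diff[OF _ assms, of 0 0] by simp

lemma dvd_diff_mult:
  fixes m :: "'a::comm_ring_1"
  assumes "m dvd a - b" "m dvd c - d" shows "m dvd a * c - b * d"
proof -
  have "m dvd (a - b) * c + b * (c - d)"
    using assms by (intro dvd_add dvd_mult dvd_mult2)
  then show ?thesis by (simp add: algebra_simps)
qed

quotient_type (overloaded) 'p R = "'p::prime_card mod_ring poly" / R_eq
  unfolding R_eq_def by (rule equivp_dvd_diff)

lemma R_modulus_not_unit: "\<not> (R_modulus :: 'p::prime_card mod_ring poly) dvd 1"
proof
  assume "(R_modulus :: 'p mod_ring poly) dvd 1"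
  then obtain k where "1 = (R_modulus :: 'p mod_ring poly) * k" by (elim dvdE)
  then have "poly 1 0 = poly ((R_modulus :: 'p mod_ring poly) * k) 0" by simp
  then show False by (simp add: R_modulus_def poly_monom)
qed

instantiation R :: (prime_card) comm_ring_1
begin

lift_definition zero_R :: "'a R" is 0 .
lift_definition one_R :: "'a R" is 1 .
lift_definition plus_R :: "'a R \<Rightarrow> 'a R \<Rightarrow> 'a R" is "(+)"
  unfolding R_eq_def by (rule dvd_diff_add)
lift_definition minus_R :: "'a R \<Rightarrow> 'a R \<Rightarrow> 'a R" is "(-)"
  unfolding R_eq_def by (rule dvd_diff_diff)
lift_definition uminus_R :: "'a R \<Rightarrow> 'a R" is uminus
  unfolding R_eq_def by (rule dvd_diff_uminus)
lift_definition times_R :: "'a R \<Rightarrow> 'a R \<Rightarrow> 'a R" is "(*)"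
  unfolding R_eq_def by (rule dvd_diff_mult)

instance
proof
  show "(0::'a R) \<noteq> 1"
    by transfer (metis R_eq_def R_modulus_not_unit diff_0 dvd_minus_iff)
qed (transfer, simp add: R_eq_def algebra_simps)+

end

definition const_R :: "'p::prime_card mod_ring \<Rightarrow> 'p R"
  where "const_R a = abs_R [:a:]"

definition u_R :: "'p::prime_card R"
  where "u_R = abs_R [:0, 1:]"

lemma u_R_power4: "(u_R :: 'p::prime_card R) ^ 4 = u_R"
proof -
  have "u_R * u_R * u_R * u_R = (u_R :: 'p R)"
    by (simp add: u_R_def times_R.abs_eq R.abs_eq_iff R_eq_def R_modulus_def monom_altdef
        numeral_eq_Suc)
  then show ?thesis by (simp add: numeral_eq_Suc algebra_simps)
qed


section \<open>The ring \<open>R\<^sub>q = R[x]/(x\<^sup>q - 1)\<close>, where \<open>q = CARD('q)\<close>\<close>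

definition Rq_eq :: "'q::finite itself \<Rightarrow> 'p::prime_card R poly \<Rightarrow> 'p R poly \<Rightarrow> bool"
  where "Rq_eq _ f g \<longleftrightarrow> Polynomial.monom 1 CARD('q) - 1 dvd f - g"

quotient_type (overloaded) ('p, 'q) Rq =
    "'p::prime_card R poly" / "Rq_eq TYPE('q::finite)"
  unfolding Rq_eq_def by (rule equivp_dvd_diff)

lemma Rq_modulus_not_unit:
  "\<not> (Polynomial.monom 1 CARD('q::finite) - 1 :: 'p::prime_card R poly) dvd 1"
proof
  assume "(Polynomial.monom 1 CARD('q) - 1 :: 'p R poly) dvd 1"
  then obtain k where "1 = (Polynomial.monom 1 CARD('q) - 1 :: 'p R poly) * k"
    by (elim dvdE)
  then have "poly 1 1 = poly ((Polynomial.monom 1 CARD('q) - 1 :: 'p R poly) * k) 1"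
    by simp
  then show False by (simp add: poly_monom)
qed

instantiation Rq :: (prime_card, finite) comm_ring_1
begin

lift_definition zero_Rq :: "('a, 'b) Rq" is 0 .
lift_definition one_Rq :: "('a, 'b) Rq" is 1 .
lift_definition plus_Rq :: "('a, 'b) Rq \<Rightarrow> ('a, 'b) Rq \<Rightarrow> ('a, 'b) Rq" is "(+)"
  unfolding Rq_eq_def by (rule dvd_diff_add)
lift_definition minus_Rq :: "('a, 'b) Rq \<Rightarrow> ('a, 'b) Rq \<Rightarrow> ('a, 'b) Rq" is "(-)"
  unfolding Rq_eq_def by (rule dvd_diff_diff)
lift_definition uminus_Rq :: "('a, 'b) Rq \<Rightarrow> ('a, 'b) Rq" is uminus
  unfolding Rq_eq_def by (rule dvd_diff_uminus)
lift_definition times_Rq :: "('a, 'b) Rq \<Rightarrow> ('a, 'b) Rq \<Rightarrow> ('a, 'b) Rq" is "(*)"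
  unfolding Rq_eq_def by (rule dvd_diff_mult)

instance
proof
  show "(0::('a, 'b) Rq) \<noteq> 1"
    by transfer (metis Rq_eq_def Rq_modulus_not_unit diff_0 dvd_minus_iff)
qed (transfer, simp add: Rq_eq_def algebra_simps)+

end

definition const_Rq :: "'p::prime_card R \<Rightarrow> ('p, 'q::finite) Rq"
  where "const_Rq r = abs_Rq [:r:]"

definition x_Rq :: "('p::prime_card, 'q::finite) Rq"
  where "x_Rq = abs_Rq [:0, 1:]"

abbreviation scalar :: "'p::prime_card mod_ring \<Rightarrow> ('p, 'q::finite) Rq"
  where "scalar a \<equiv> const_Rq (const_R a)"


section \<open>Ideals and codes\<close>

definition is_ideal :: "'a::comm_ring_1 set \<Rightarrow> bool"
  where "is_ideal I \<longleftrightarrow>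
    0 \<in> I \<and> (\<forall>a\<in>I. \<forall>b\<in>I. a + b \<in> I) \<and> (\<forall>r. \<forall>a\<in>I. r * a \<in> I)"

definition ideal_gen :: "'a::comm_ring_1 \<Rightarrow> 'a set"
  where "ideal_gen g = is_ideal hull {g}"

lemma ideal_gen_eq: "ideal_gen g = range (\<lambda>r. r * g)"
  unfolding ideal_gen_def
proof (rule hull_unique)
  show "{g} \<subseteq> range (\<lambda>r. r * g)"
    by (auto intro: range_eqI[of _ _ 1])
  show "is_ideal (range (\<lambda>r. r * g))"
    unfolding is_ideal_def
    by (auto simp: image_iff) (metis mult_zero_left, metis distrib_right, metis mult.assoc)
qed (auto simp: is_ideal_def)

text \<open>
  A word \<open>(a\<^sub>0, \<dots>, a\<^bsub>q-1\<^esub>)\<close> over \<open>R\<close> is identified with \<open>a\<^sub>0 + a\<^sub>1 x + \<dots> + a\<^bsub>q-1\<^esub> x\<^bsup>q-1\<^esup>\<close>; only the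
  values of \<open>a\<close> below \<open>q\<close> matter.
\<close>

definition word_Rq :: "(nat \<Rightarrow> 'p::prime_card R) \<Rightarrow> ('p, 'q::finite) Rq"
  where "word_Rq a = (\<Sum>i<CARD('q). const_Rq (a i) * x_Rq ^ i)"

definition code_equiv ::
    "('p::prime_card, 'q::finite) Rq set \<Rightarrow> ('p, 'q) Rq set \<Rightarrow> bool"
  where "code_equiv C D \<longleftrightarrow>
    (\<exists>\<pi> w. \<pi> permutes {..<CARD('q)} \<and> (\<forall>i<CARD('q). w i dvd 1) \<and>
      D = {word_Rq (\<lambda>i. w i * a (\<pi> i)) | a. word_Rq a \<in> C})"


section \<open>Quadratic residue codes\<close>

definition primitive_root_of_unity :: "nat \<Rightarrow> 'a::comm_ring_1 \<Rightarrow> bool"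
  where "primitive_root_of_unity n z \<longleftrightarrow> z ^ n = 1 \<and> (\<forall>k. 0 < k \<and> k < n \<longrightarrow> z ^ k \<noteq> 1)"

text \<open>
  \<^const>\<open>QuadRes\<close> also holds at \<open>0\<close>, which therefore has to be excluded from the index range.
\<close>

definition residues_mod :: "nat \<Rightarrow> nat set"
  where "residues_mod q = {i \<in> {1..<q}. QuadRes (int q) (int i)}"

definition nonresidues_mod :: "nat \<Rightarrow> nat set"
  where "nonresidues_mod q = {i \<in> {1..<q}. \<not> QuadRes (int q) (int i)}"

definition j1 :: "('p::prime_card, 'q::finite) Rq"
  where "j1 = (\<Sum>i\<in>residues_mod CARD('q). x_Rq ^ i)"

definition j2 :: "('p::prime_card, 'q::finite) Rq"
  where "j2 = (\<Sum>i\<in>nonresidues_mod CARD('q). x_Rq ^ i)"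

definition h_Rq :: "('p::prime_card, 'q::finite) Rq"
  where "h_Rq = 1 + j1 + j2"

text \<open>
  The sum is taken in the algebraic closure of \<open>F\<^sub>p\<close>; \<^const>\<open>of_ac\<close> maps an element that lies in
  \<open>F\<^sub>p\<close> back to \<open>F\<^sub>p\<close>.
\<close>

definition gauss_sum :: "nat \<Rightarrow> 'p::prime_card mod_ring alg_closure \<Rightarrow> 'p mod_ring"
  where "gauss_sum q \<alpha> = of_ac (\<Sum>i=1..q-1. of_int (Legendre (int i) (int q)) * \<alpha> ^ i)"

definition e1 :: "'p::prime_card mod_ring \<Rightarrow> ('p, 'q::finite) Rq"
  where "e1 \<theta> = (let n = of_nat CARD('q) in
    scalar (1/2 * (1 + 1/n)) + scalar (1/2 * (1/n - 1/\<theta>)) * j1 + scalar (1/2 * (1/n + 1/\<theta>)) * j2)"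

definition e2 :: "'p::prime_card mod_ring \<Rightarrow> ('p, 'q::finite) Rq"
  where "e2 \<theta> = (let n = of_nat CARD('q) in
    scalar (1/2 * (1 + 1/n)) + scalar (1/2 * (1/n - 1/\<theta>)) * j2 + scalar (1/2 * (1/n + 1/\<theta>)) * j1)"

definition e1_tilde :: "'p::prime_card mod_ring \<Rightarrow> ('p, 'q::finite) Rq"
  where "e1_tilde \<theta> = (let n = of_nat CARD('q) in
    scalar (1/2 * (1 - 1/n)) - scalar (1/2 * (1/n + 1/\<theta>)) * j1 - scalar (1/2 * (1/n - 1/\<theta>)) * j2)"

definition e2_tilde :: "'p::prime_card mod_ring \<Rightarrow> ('p, 'q::finite) Rq"
  where "e2_tilde \<theta> = (let n = of_nat CARD('q) in
    scalar (1/2 * (1 - 1/n)) - scalar (1/2 * (1/n + 1/\<theta>)) * j2 - scalar (1/2 * (1/n - 1/\<theta>)) * j1)"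

definition eta :: "'p::prime_card mod_ring \<Rightarrow> nat \<Rightarrow> 'p R"
  where "eta \<xi> i =
    (if i = 1 then 1 - u_R ^ 3
     else if i = 2 then const_R (1/3) * (u_R + u_R ^ 2 + u_R ^ 3)
     else if i = 3 then const_R (1/3) * (const_R \<xi> * u_R + const_R (\<xi> ^ 2) * u_R ^ 2 + u_R ^ 3)
     else if i = 4 then const_R (1/3) * (const_R (\<xi> ^ 2) * u_R + const_R \<xi> * u_R ^ 2 + u_R ^ 3)
     else undefined)"

text \<open>
  The generators of both families \<open>Q\<^sub>k\<close> and \<open>S\<^sub>k\<close> (\<open>1 \<le> k \<le> 14\<close>) arise by the same recipe, from
  \<open>(a, b) = (e\<^sub>1, e\<^sub>2)\<close> and from the pair of their tilde versions respectively.
  For \<open>k = 9, 10, 11\<close> the index pair \<open>(i, j)\<close> is \<open>(1, k - 7)\<close>.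
\<close>

definition code_generator ::
    "'p::prime_card mod_ring \<Rightarrow> ('p, 'q::finite) Rq \<Rightarrow> ('p, 'q) Rq \<Rightarrow> nat \<Rightarrow> ('p, 'q) Rq"
  where "code_generator \<xi> a b k = (let c = (\<lambda>i. const_Rq (eta \<xi> i)) in
    if k \<in> {1..4} then (1 - c k) * a + c k * b
    else if k \<in> {5..8} then c (k - 4) * a + (1 - c (k - 4)) * b
    else if k \<in> {9..11} then (c 1 + c (k - 7)) * a + (1 - c 1 - c (k - 7)) * b
    else if k \<in> {12..14} then (c 1 + c (k - 10)) * b + (1 - c 1 - c (k - 10)) * a
    else undefined)"

definition Q_code ::
    "'p::prime_card mod_ring \<Rightarrow> 'p mod_ring alg_closure \<Rightarrow> nat \<Rightarrow> ('p, 'q::finite) Rq set"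
  where "Q_code \<xi> \<alpha> k = (let \<theta> = gauss_sum CARD('q) \<alpha> in
    ideal_gen (code_generator \<xi> (e1 \<theta>) (e2 \<theta>) k))"

definition S_code ::
    "'p::prime_card mod_ring \<Rightarrow> 'p mod_ring alg_closure \<Rightarrow> nat \<Rightarrow> ('p, 'q::finite) Rq set"
  where "S_code \<xi> \<alpha> k = (let \<theta> = gauss_sum CARD('q) \<alpha> in
    ideal_gen (code_generator \<xi> (e1_tilde \<theta>) (e2_tilde \<theta>) k))"

end

theory Submission
  imports Defs "HOL-Number_Theory.Number_Theory"
begin

text \<open>
  Write \<open>f\<^sub>1, f\<^sub>2\<close> for the two tilde elements and \<open>h'\<close> for \<open>h / q\<close>. Evaluating at the powers of the primitive
  root \<open>\<alpha>\<close> in the algebraic closure shows that \<open>f\<^sub>1, f\<^sub>2, h'\<close> are orthogonal idempotents with sum \<open>1\<close>;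
  moreover \<open>e\<^sub>i = f\<^sub>i + h'\<close>. The codes \<open>S\<^sub>k\<close> and \<open>Q\<^sub>k\<close> are generated by \<open>a = (1 - c) f\<^sub>1 + c f\<^sub>2\<close> and
  \<open>a + h'\<close> for an idempotent \<open>c\<close> of \<open>R\<close>, and the partner code belongs to \<open>1 - c\<close>, with generator
  \<open>b = 1 - h' - a\<close>. So \<open>a, b, h'\<close> are again orthogonal idempotents with sum \<open>1\<close>, which gives all
  statements on sums and intersections. For a nonresidue \<open>n\<close> the substitution \<open>x \<mapsto> x\<^sup>n\<close> permutes the
  coordinates and exchanges \<open>f\<^sub>1\<close> and \<open>f\<^sub>2\<close>, hence \<open>a\<close> and \<open>b\<close>. In particular
  \<open>p\<^bsup>4q\<^esup> = |\<langle>a\<rangle>| |\<langle>b\<rangle>| |\<langle>h'\<rangle>| = |\<langle>a\<rangle>|\<^sup>2 p\<^sup>4\<close>, which determines all cardinalities.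
\<close>

hide_const (open) Polynomials.lead_coeff Polynomials.degree up_ring.coeff up_ring.monom
  Divisibility.prime

section \<open>Ideals generated by idempotents, and quotients by monic polynomials\<close>

lemma in_ideal_gen: "x \<in> ideal_gen g \<longleftrightarrow> (\<exists>r. x = r * g)"
  by (auto simp: ideal_gen_eq)

lemma in_ideal_gen_idem:
  assumes "g * g = g"
  shows "x \<in> ideal_gen g \<longleftrightarrow> x * g = x"
  using assms by (metis in_ideal_gen mult.assoc)

text \<open>By orthogonality, \<open>a + b\<close> acts as the identity on every
  \<open>r * a + s * b\<close>, so such an element is a multiple of \<open>a + b\<close>.\<close>

lemma ideal_gen_sum:
  assumes "a * a = a" "b * b = b" "a * b = (0 :: 'a::comm_ring_1)"
  shows "ideal_gen a + ideal_gen b = ideal_gen (a + b)"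
proof -
  have "r * a + s * b = (r * a + s * b) * (a + b)" for r s
  proof -
    have "(r * a + s * b) * (a + b) = r * (a * a) + s * (b * b) + (r + s) * (a * b)"
      by (simp add: algebra_simps)
    then show ?thesis by (simp add: assms)
  qed
  then have "x \<in> ideal_gen (a + b)" if "x = r * a + s * b" for x r s
    unfolding in_ideal_gen using that by blast
  moreover have "r * (a + b) \<in> ideal_gen a + ideal_gen b" for r
    unfolding distrib_left by (rule set_plus_intro) (auto simp: in_ideal_gen)
  ultimately show ?thesis
    by (auto simp: in_ideal_gen elim!: set_plus_elim)
qed

text \<open>Membership in an ideal with idempotent generator means being fixed by that generator.
  Being fixed by both \<open>a\<close> and \<open>b\<close> is the same as being fixed by
  \<open>a * b\<close>, which is again idempotent.\<close>

lemma ideal_gen_inter: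
  assumes "a * a = a" "b * b = (b :: 'a::comm_ring_1)"
  shows "ideal_gen a \<inter> ideal_gen b = ideal_gen (a * b)"
proof -
  have ab: "a * b * a = a * b" "a * b * b = a * b"
    using assms by (simp_all add: mult.assoc mult.commute[of b a]) (simp flip: mult.assoc)
  then have "a * b * (a * b) = a * b"
    by (simp flip: mult.assoc)
  moreover have "x * a = x \<and> x * b = x \<longleftrightarrow> x * (a * b) = x" for x
  proof
    assume "x * (a * b) = x"
    then show "x * a = x \<and> x * b = x"
      using ab mult.assoc[of x "a * b"] by metis
  qed (simp flip: mult.assoc)
  ultimately show ?thesis by (simp add: set_eq_iff in_ideal_gen_idem assms)
qed

lemma ideal_gen_0: "ideal_gen 0 = {0}"
  by (auto simp: in_ideal_gen)

lemma ideal_gen_1: "ideal_gen 1 = UNIV"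
  by (auto simp: in_ideal_gen)

text \<open>The sum is direct: multiplying by \<open>a\<close> and by \<open>b\<close> recovers the
  two summands.\<close>

lemma card_ideal_gen_sum:
  assumes "a * a = a" "b * b = b" "a * b = (0 :: 'a::comm_ring_1)"
  shows "card (ideal_gen (a + b)) = card (ideal_gen a) * card (ideal_gen b)"
proof -
  have "inj_on (\<lambda>(x, y). x + y) (ideal_gen a \<times> ideal_gen b)"
  proof (rule inj_on_inverseI[where g = "\<lambda>z. (z * a, z * b)"])
    fix z assume "z \<in> ideal_gen a \<times> ideal_gen b"
    then obtain r s where "z = (r * a, s * b)" by (auto simp: in_ideal_gen)
    moreover have "(r * a + s * b) * a = r * (a * a) + s * (a * b)"
      "(r * a + s * b) * b = r * (a * b) + s * (b * b)"
      by (simp_all add: algebra_simps)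
    ultimately show "((case z of (x, y) \<Rightarrow> x + y) * a, (case z of (x, y) \<Rightarrow> x + y) * b) = z"
      by (simp add: assms)
  qed
  moreover have "(\<lambda>(x, y). x + y) ` (ideal_gen a \<times> ideal_gen b) = ideal_gen (a + b)"
    unfolding ideal_gen_sum[OF assms, symmetric] by (auto simp: set_plus_def image_iff)
  ultimately have "bij_betw (\<lambda>(x, y). x + y) (ideal_gen a \<times> ideal_gen b) (ideal_gen (a + b))"
    by (rule bij_betw_imageI)
  then show ?thesis by (simp add: card_cartesian_product flip: bij_betw_same_card)
qed

section \<open>Division with remainder by a monic polynomial over a commutative ring\<close>

lemma monic_multiple_eq_0:
  fixes m d :: "'a::comm_ring_1 poly"
  assumes "lead_coeff m = 1" "m dvd d" "\<And>i. i \<ge> degree m \<Longrightarrow> coeff d i = 0"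
  shows "d = 0"
proof -
  obtain k where k: "d = m * k" using assms(2) by (elim dvdE)
  \<comment> \<open>Since \<open>m\<close> is monic, the top coefficient of the product survives
    even in the presence of zero divisors, as in \<open>R\<close>.\<close>
  have "lead_coeff k = coeff d (degree m + degree k)"
    by (simp add: k coeff_mult_degree_sum assms(1))
  then have "lead_coeff k = 0" by (simp add: assms(3))
  then show ?thesis by (simp add: k)
qed

lemma coeff_sum_monom:
  "coeff (\<Sum>i<n. monom (a i) i) j = (if j < n then a j else 0)"
  by (simp add: coeff_sum)

lemma monic_remainder_exists:
  fixes m f :: "'a::comm_ring_1 poly"
  assumes "lead_coeff m = 1"
  obtains a where "m dvd f - (\<Sum>i<degree m. monom (a i) i)"
proof -
  have "m \<noteq> 0" using assms by auto
  obtain k r where "pseudo_divmod f m = (k, r)" by force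
  \<comment> \<open>Pseudo-division scales the dividend by a power of the leading coefficient of
    \<open>m\<close>; that coefficient is 1, so this is true division.\<close>
  from pseudo_divmod[OF \<open>m \<noteq> 0\<close> this] assms
  have f: "f = m * k + r" and r: "r = 0 \<or> degree r < degree m" by auto
  have "r = (\<Sum>i<degree m. monom (coeff r i) i)"
    by (rule poly_eqI) (use r in \<open>auto simp: coeff_sum_monom coeff_eq_0\<close>)
  with f have "m dvd f - (\<Sum>i<degree m. monom (coeff r i) i)" by simp
  then show thesis by (rule that)
qed

lemma monic_remainder_unique:
  fixes m :: "'a::comm_ring_1 poly"
  assumes "lead_coeff m = 1" "i < degree m"
    and "m dvd (\<Sum>i<degree m. monom (a i) i) - (\<Sum>i<degree m. monom (b i) i)"
  shows "a i = b i"
proof -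
  have "(\<Sum>i<degree m. monom (a i) i) - (\<Sum>i<degree m. monom (b i) i) = 0"
    by (rule monic_multiple_eq_0[OF assms(1,3)]) (simp add: coeff_sum_monom)
  then have "coeff (\<Sum>i<degree m. monom (a i) i) i = coeff (\<Sum>i<degree m. monom (b i) i) i"
    by simp
  then show ?thesis using assms(2) by (simp add: coeff_sum_monom)
qed

text \<open>The polynomials of degree below \<open>degree m\<close> represent each class exactly
  once. The projection is kept abstract so that the count serves both \<open>R\<close> and
  \<open>Rq\<close>.\<close>

lemma card_monic_quotient:
  fixes m :: "'a::comm_ring_1 poly" and proj :: "'a poly \<Rightarrow> 'b"
  assumes "lead_coeff m = 1" "surj proj" "\<And>f g. proj f = proj g \<longleftrightarrow> m dvd f - g"
  shows "CARD('b) = CARD('a) ^ degree m"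
proof -
  let ?w = "\<lambda>a. proj (\<Sum>i<degree m. monom (a i) i)"
  \<comment> \<open>Extensional functions count each coefficient tuple once, whatever a function
    does beyond the degree.\<close>
  have "inj_on ?w ({..<degree m} \<rightarrow>\<^sub>E UNIV)"
  proof (rule inj_onI)
    fix a b :: "nat \<Rightarrow> 'a"
    assume ab: "a \<in> {..<degree m} \<rightarrow>\<^sub>E UNIV" "b \<in> {..<degree m} \<rightarrow>\<^sub>E UNIV" and "?w a = ?w b"
    then have "\<forall>i<degree m. a i = b i"
      using monic_remainder_unique[OF assms(1)] by (simp add: assms(3))
    then show "a = b" using ab by (intro PiE_ext[of a _ _ b]) auto
  qed
  moreover have "?w ` ({..<degree m} \<rightarrow>\<^sub>E UNIV) = UNIV"
  proof (intro equalityI subset_UNIV subsetI)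
    fix y :: 'b
    obtain f where f: "y = proj f" using assms(2) by (elim surjE)
    obtain a where a: "m dvd f - (\<Sum>i<degree m. monom (a i) i)"
      by (rule monic_remainder_exists[OF assms(1)])
    have "(\<Sum>i<degree m. monom (restrict a {..<degree m} i) i) = (\<Sum>i<degree m. monom (a i) i)"
      by (rule sum.cong) auto
    then have "y = ?w (restrict a {..<degree m})"
      using a by (simp add: f assms(3))
    then show "y \<in> ?w ` ({..<degree m} \<rightarrow>\<^sub>E UNIV)"
      by (intro image_eqI[where x = "restrict a {..<degree m}"]) auto
  qed
  ultimately have "bij_betw ?w ({..<degree m} \<rightarrow>\<^sub>E UNIV) UNIV"
    by (rule bij_betw_imageI)
  then show ?thesis by (simp add: card_PiE flip: bij_betw_same_card)
qed

lemma lead_coeff_monom_minus: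
  fixes g :: "'a::comm_ring_1 poly"
  assumes "degree g < n"
  shows "degree (monom 1 n - g) = n" "lead_coeff (monom 1 n - g) = 1"
proof -
  show "degree (monom 1 n - g) = n"
    by (rule antisym, rule degree_le)
      (use assms in \<open>auto simp: coeff_eq_0 intro: le_degree\<close>)
  then show "lead_coeff (monom 1 n - g) = 1" using assms by (simp add: coeff_eq_0)
qed

lemma R_modulus_monic:
  "degree (R_modulus :: 'p::prime_card mod_ring poly) = 4"
  "lead_coeff (R_modulus :: 'p::prime_card mod_ring poly) = 1"
  unfolding R_modulus_def by (simp_all add: lead_coeff_monom_minus degree_monom_eq)

lemma card_R: "CARD('p::prime_card R) = CARD('p) ^ 4"
proof -
  have "surj (abs_R :: 'p mod_ring poly \<Rightarrow> 'p R)"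
    by (metis Quotient_R Quotient_abs_rep surjI)
  moreover have "abs_R f = abs_R g \<longleftrightarrow> R_modulus dvd f - g" for f g :: "'p mod_ring poly"
    by (simp add: R.abs_eq_iff R_eq_def)
  ultimately show ?thesis
    using card_monic_quotient[OF R_modulus_monic(2), of "abs_R :: _ \<Rightarrow> 'p R"]
    by (simp add: R_modulus_monic)
qed

lemma Rq_modulus_monic:
  "degree (monom 1 CARD('q::finite) - 1 :: 'a::comm_ring_1 poly) = CARD('q)"
  "lead_coeff (monom 1 CARD('q::finite) - 1 :: 'a::comm_ring_1 poly) = 1"
  by (simp_all add: lead_coeff_monom_minus)

lemma surj_abs_Rq: "surj (abs_Rq :: _ \<Rightarrow> ('p::prime_card, 'q::finite) Rq)"
  by (metis Quotient_Rq Quotient_abs_rep surjI)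

lemma abs_Rq_eq_iff:
  "abs_Rq f = (abs_Rq g :: ('p::prime_card, 'q::finite) Rq) \<longleftrightarrow>
    monom 1 CARD('q) - 1 dvd f - g"
  by (simp add: Rq.abs_eq_iff Rq_eq_def)

lemma card_Rq: "CARD(('p::prime_card, 'q::finite) Rq) = CARD('p) ^ (4 * CARD('q))"
  using card_monic_quotient[OF Rq_modulus_monic(2) surj_abs_Rq abs_Rq_eq_iff]
  by (simp add: Rq_modulus_monic card_R power_mult)

lemma const_R_0 [simp]: "const_R 0 = 0"
  and const_R_1 [simp]: "const_R 1 = 1"
  and const_R_add: "const_R (a + b) = const_R a + const_R b"
  and const_R_diff: "const_R (a - b) = const_R a - const_R b"
  and const_R_mult: "const_R (a * b) = const_R a * const_R b"
  by (simp_all add: const_R_def zero_R_def one_R_def plus_R.abs_eq minus_R.abs_eq times_R.abs_eq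
      one_pCons mult.commute)

lemma const_R_power: "const_R (a ^ n) = const_R a ^ n"
  by (induction n) (simp_all add: const_R_mult)

lemma const_Rq_0 [simp]: "const_Rq 0 = 0"
  and const_Rq_1 [simp]: "const_Rq 1 = 1"
  and const_Rq_add: "const_Rq (a + b) = const_Rq a + const_Rq b"
  and const_Rq_diff: "const_Rq (a - b) = const_Rq a - const_Rq b"
  and const_Rq_mult: "const_Rq (a * b) = const_Rq a * const_Rq b"
  by (simp_all add: const_Rq_def zero_Rq_def one_Rq_def plus_Rq.abs_eq minus_Rq.abs_eq
      times_Rq.abs_eq one_pCons mult.commute)

lemma const_Rq_sum: "const_Rq (sum f A) = (\<Sum>i\<in>A. const_Rq (f i))"
  by (induction A rule: infinite_finite_induct) (simp_all add: const_Rq_add)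

lemma abs_Rq_power: "abs_Rq (f ^ n) = abs_Rq f ^ n"
  by (induction n) (simp_all add: one_Rq_def flip: times_Rq.abs_eq)

lemma abs_Rq_sum: "abs_Rq (sum f A) = (\<Sum>i\<in>A. abs_Rq (f i))"
  by (induction A rule: infinite_finite_induct) (simp_all add: zero_Rq_def flip: plus_Rq.abs_eq)

lemma abs_Rq_monom: "abs_Rq (monom c i) = const_Rq c * x_Rq ^ i"
proof -
  have "monom c i = [:c:] * [:0, 1:] ^ i"
    by (simp add: monom_altdef)
  then show ?thesis
    by (simp add: const_Rq_def x_Rq_def times_Rq.abs_eq flip: abs_Rq_power)
qed

lemma word_Rq_eq_abs:
  "(word_Rq a :: ('p::prime_card, 'q::finite) Rq) = abs_Rq (\<Sum>i<CARD('q). monom (a i) i)"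
  by (simp add: word_Rq_def abs_Rq_sum abs_Rq_monom)

lemma word_Rq_surj:
  obtains a where "(z :: ('p::prime_card, 'q::finite) Rq) = word_Rq a"
proof -
  obtain f where f: "z = abs_Rq f" using surj_abs_Rq by (elim surjE)
  obtain a where "monom 1 CARD('q) - 1 dvd f - (\<Sum>i<CARD('q). monom (a i) i)"
    using monic_remainder_exists[OF Rq_modulus_monic(2)[where 'q = 'q]]
    unfolding Rq_modulus_monic by blast
  then have "z = word_Rq a" by (simp add: f word_Rq_eq_abs abs_Rq_eq_iff)
  then show thesis by (rule that)
qed

lemma word_Rq_inj:
  assumes "(word_Rq a :: ('p::prime_card, 'q::finite) Rq) = word_Rq b" "i < CARD('q)"
  shows "a i = b i"
  using assms monic_remainder_unique[OF Rq_modulus_monic(2)[where 'q = 'q], unfolded Rq_modulus_monic]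
  by (simp add: word_Rq_eq_abs abs_Rq_eq_iff)

lemma x_Rq_power_card: "(x_Rq :: ('p::prime_card, 'q::finite) Rq) ^ CARD('q) = 1"
proof -
  have "(x_Rq :: ('p, 'q) Rq) ^ CARD('q) = abs_Rq (monom 1 CARD('q))"
    by (simp add: abs_Rq_monom)
  also have "\<dots> = 1" by (simp add: one_Rq_def abs_Rq_eq_iff)
  finally show ?thesis .
qed

section \<open>The substitution of a power of \<open>x\<close> and the equivalence of codes\<close>

lemma power_mod_period:
  assumes "(y :: 'a::monoid_mult) ^ q = 1"
  shows "y ^ (i mod q) = y ^ i"
proof -
  have "y ^ i = y ^ (q * (i div q) + i mod q)" by simp
  also have "\<dots> = y ^ (i mod q)" by (simp only: power_add power_mult assms) simp
  finally show ?thesis by simp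
qed

text \<open>The ring endomorphism with \<open>x \<mapsto> x^n\<close>. It respects the quotient
  because the modulus \<open>x^q - 1\<close> is sent to \<open>x^(n*q) - 1\<close>, a multiple of
  itself.\<close>

lift_definition power_subst :: "nat \<Rightarrow> ('p::prime_card, 'q::finite) Rq \<Rightarrow> ('p, 'q) Rq"
  is "\<lambda>n f. pcompose f (monom 1 n)"
proof -
  fix n and f g :: "'p R poly"
  assume "Rq_eq TYPE('q) f g"
  then obtain k where "f - g = (monom 1 CARD('q) - 1) * k"
    unfolding Rq_eq_def by (elim dvdE)
  then have "pcompose f (monom 1 n) - pcompose g (monom 1 n) =
      pcompose (monom 1 CARD('q) - 1) (monom 1 n) * pcompose k (monom 1 n)"
    by (simp flip: pcompose_diff pcompose_mult)
  moreover have "pcompose (monom 1 j) (monom 1 n) = (monom 1 n ^ j :: 'p R poly)" for j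
    by (induction j) (simp_all add: monom_0 monom_Suc pcompose_pCons one_pCons)
  then have "pcompose (monom 1 CARD('q) - 1) (monom 1 n) = (monom 1 CARD('q) ^ n - 1 :: 'p R poly)"
    by (simp add: pcompose_diff pcompose_1 monom_power mult.commute)
  moreover have "(monom 1 CARD('q) - 1 :: 'p R poly) dvd monom 1 CARD('q) ^ n - 1"
    by (simp add: power_diff_1_eq)
  ultimately show "Rq_eq TYPE('q) (pcompose f (monom 1 n)) (pcompose g (monom 1 n))"
    unfolding Rq_eq_def by simp
qed

lemma power_subst_add: "power_subst n (a + b) = power_subst n a + power_subst n b"
  and power_subst_diff: "power_subst n (a - b) = power_subst n a - power_subst n b"
  and power_subst_mult: "power_subst n (a * b) = power_subst n a * power_subst n b"
  by (transfer; simp add: Rq_eq_def pcompose_add pcompose_diff pcompose_mult)+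

lemma power_subst_const [simp]: "power_subst n (const_Rq c) = const_Rq c"
  by (simp add: const_Rq_def power_subst.abs_eq)

lemma power_subst_x [simp]: "power_subst n x_Rq = x_Rq ^ n"
proof -
  have "power_subst n x_Rq = abs_Rq (monom 1 n)"
    by (simp add: x_Rq_def power_subst.abs_eq pcompose_pCons)
  then show ?thesis by (simp add: abs_Rq_monom)
qed

lemma power_subst_1 [simp]: "power_subst n 1 = 1"
  using power_subst_const[of n 1] by (simp del: power_subst_const)

lemma power_subst_power: "power_subst n (a ^ i) = power_subst n a ^ i"
  by (induction i) (simp_all add: power_subst_mult)

lemma power_subst_sum: "power_subst n (sum f A) = (\<Sum>i\<in>A. power_subst n (f i))"
proof (induction A rule: infinite_finite_induct)
  have "power_subst n 0 = 0"
    using power_subst_const[of n 0] by (simp del: power_subst_const)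
  then show "power_subst n (sum f {}) = (\<Sum>i\<in>{}. power_subst n (f i))"
    and "infinite A \<Longrightarrow> power_subst n (sum f A) = (\<Sum>i\<in>A. power_subst n (f i))" for A
    by simp_all
qed (simp add: power_subst_add)

lemma power_subst_word:
  "power_subst n (word_Rq a :: ('p::prime_card, 'q::finite) Rq) =
    (\<Sum>i<CARD('q). const_Rq (a i) * x_Rq ^ (n * i))"
  by (simp add: word_Rq_def power_subst_sum power_subst_mult power_subst_power power_mult)

text \<open>The exponent \<open>i\<close> becomes \<open>m * n * i\<close>, which agrees with
  \<open>i\<close> modulo \<open>q\<close>, and \<open>x^q = 1\<close>.\<close>

lemma power_subst_inverse:
  assumes "[m * n = 1] (mod CARD('q))"
  shows "power_subst m (power_subst n (z :: ('p::prime_card, 'q::finite) Rq)) = z"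
proof -
  obtain a where a: "z = word_Rq a" by (rule word_Rq_surj)
  have "[m * (n * i) = i] (mod CARD('q))" for i
    using cong_mult[OF assms cong_refl[of i]] by (simp add: mult.assoc)
  then have x: "x_Rq ^ (m * (n * i)) = (x_Rq ^ i :: ('p, 'q) Rq)" for i
    by (metis cong_def power_mod_period x_Rq_power_card)
  have "power_subst m (power_subst n z) =
      (\<Sum>i<CARD('q). const_Rq (a i) * x_Rq ^ (m * (n * i)))"
    by (simp add: a power_subst_word power_subst_sum power_subst_mult power_subst_power
        flip: power_mult)
  then show ?thesis by (simp add: x a word_Rq_def)
qed

lemma power_subst_ideal_gen:
  assumes "[m * n = 1] (mod CARD('q))"
  shows "power_subst n ` ideal_gen (g :: ('p::prime_card, 'q::finite) Rq) =
    ideal_gen (power_subst n g)"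
proof -
  have "r * power_subst n g \<in> power_subst n ` ideal_gen g" for r
  proof (rule image_eqI)
    \<comment> \<open>The cofactor is pulled back by the inverse substitution, which makes the image
      a full ideal.\<close>
    show "r * power_subst n g = power_subst n (power_subst m r * g)"
      using assms by (simp add: power_subst_mult power_subst_inverse mult.commute)
  qed (auto simp: in_ideal_gen)
  moreover have "power_subst n (r * g) \<in> ideal_gen (power_subst n g)" for r
    unfolding power_subst_mult in_ideal_gen by blast
  ultimately show ?thesis
    by (auto simp: in_ideal_gen[of _ g] in_ideal_gen[of _ "power_subst n g"])
qed

lemma code_equiv_power_subst:
  fixes C :: "('p::prime_card, 'q::finite) Rq set"
  assumes "[m * n = 1] (mod CARD('q))"
  shows "code_equiv C (power_subst n ` C)"
proof -
  let ?q = "CARD('q)"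
  \<comment> \<open>Coordinate \<open>i\<close> of the new word comes from the index that
    \<open>n\<close> sends to \<open>i\<close>, hence the inverse \<open>m\<close> here and
    \<open>n\<close> in \<open>\<tau>\<close>. Outside the range \<open>permutes\<close> demands the
    identity.\<close>
  define \<pi> where "\<pi> = (\<lambda>i. if i < ?q then (m * i) mod ?q else i)"
  define \<tau> where "\<tau> = (\<lambda>i. if i < ?q then (n * i) mod ?q else i)"
  have *: "(m * (n * i)) mod ?q = i" if "i < ?q" for i
    using cong_mult[OF assms cong_refl[of i]] that by (simp add: mult.assoc cong_def)
  have inv: "\<pi> (\<tau> i) = i" "\<tau> (\<pi> i) = i" for i
    using *[of i] by (auto simp: \<pi>_def \<tau>_def mod_mult_right_eq mult.left_commute)
  have \<pi>: "\<pi> permutes {..<?q}"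
    by (rule bij_imp_permutes[OF bij_betw_byWitness[where f' = \<tau>]])
      (auto simp: inv, auto simp: \<pi>_def \<tau>_def)
  have subst_word: "power_subst n (word_Rq a :: ('p, 'q) Rq) = word_Rq (\<lambda>i. a (\<pi> i))" for a
  proof -
    have "word_Rq (\<lambda>i. a (\<pi> i)) = (\<Sum>i<?q. const_Rq (a i) * x_Rq ^ \<tau> i :: ('p, 'q) Rq)"
      unfolding word_Rq_def
      by (rule sum.reindex_bij_witness[where i = \<tau> and j = \<pi>])
        (auto simp: inv, auto simp: \<pi>_def \<tau>_def)
    also have "\<dots> = power_subst n (word_Rq a)"
      unfolding power_subst_word
      by (rule sum.cong) (auto simp: \<tau>_def power_mod_period x_Rq_power_card)
    finally show ?thesis by simp
  qed
  have "power_subst n ` C = {word_Rq (\<lambda>i. 1 * a (\<pi> i)) | a. word_Rq a \<in> C}"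
  proof (intro equalityI subsetI)
    fix z :: "('p, 'q) Rq" assume "z \<in> power_subst n ` C"
    then obtain c where c: "c \<in> C" "z = power_subst n c" by blast
    moreover obtain a where "c = word_Rq a" by (rule word_Rq_surj)
    ultimately show "z \<in> {word_Rq (\<lambda>i. 1 * a (\<pi> i)) | a. word_Rq a \<in> C}"
      by (auto simp: subst_word)
  next
    fix z :: "('p, 'q) Rq" assume "z \<in> {word_Rq (\<lambda>i. 1 * a (\<pi> i)) | a. word_Rq a \<in> C}"
    then obtain a where a: "word_Rq a \<in> C" and "z = word_Rq (\<lambda>i. a (\<pi> i))" by auto
    then have "z = power_subst n (word_Rq a)" by (simp only: subst_word)
    then show "z \<in> power_subst n ` C" using a by (rule image_eqI)
  qed
  then show ?thesis
    unfolding code_equiv_def using \<pi> by (intro exI[of _ \<pi>] exI[of _ "\<lambda>_. 1"]) auto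
qed

section \<open>Quadratic residues and sums of powers over residue classes\<close>

lemma Legendre_cases: "Legendre a n \<in> {-1, 0, 1}"
  by (simp add: Legendre_def)

lemma Legendre_cong: "[a = b] (mod n) \<Longrightarrow> Legendre a n = Legendre b n"
  by (simp add: Legendre_def QuadRes_def cong_def)

text \<open>Euler's criterion gives the equation modulo \<open>q\<close>. The two sides differ by at
  most 2 and \<open>q\<close> exceeds 2, so they are equal.\<close>

lemma Legendre_mult:
  fixes q :: nat
  assumes "prime q" "odd q"
  shows "Legendre (a * b) q = Legendre a q * Legendre b q"
proof -
  have "2 < q" using assms prime_ge_2_nat[of q] by (cases "q = 2") auto
  have euler: "[Legendre c q = c ^ ((q - 1) div 2)] (mod q)" for c
    using euler_criterion[of q] assms(1) \<open>2 < q\<close> by simp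
  have "[Legendre (a * b) q = a ^ ((q - 1) div 2) * b ^ ((q - 1) div 2)] (mod q)"
    using euler[of "a * b"] by (simp add: power_mult_distrib)
  also have "[a ^ ((q - 1) div 2) * b ^ ((q - 1) div 2) = Legendre a q * Legendre b q] (mod q)"
    by (intro cong_mult cong_sym[OF euler])
  finally have "int q dvd Legendre (a * b) q - Legendre a q * Legendre b q"
    by (simp add: cong_iff_dvd_diff)
  moreover have "\<bar>Legendre (a * b) q - Legendre a q * Legendre b q\<bar> \<le> 2"
    using Legendre_cases[of a q] Legendre_cases[of b q] Legendre_cases[of "a * b" q] by auto
  ultimately show ?thesis
    using \<open>2 < q\<close> zdvd_not_zless[of "\<bar>Legendre (a * b) q - Legendre a q * Legendre b q\<bar>" "int q"]
    by auto
qed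

lemma Legendre_eq_0_iff: "Legendre (int k) (int q) = 0 \<longleftrightarrow> q dvd k"
  by (simp add: Legendre_def cong_0_iff)

text \<open>A primitive root is a nonresidue: otherwise Euler's criterion would make its order
  divide \<open>(q - 1) div 2\<close>.\<close>

lemma nonresidue_exists:
  assumes "prime q" "odd q"
  obtains k where "Legendre (int k) (int q) = -1"
proof -
  have "2 < q" using assms prime_ge_2_nat[of q] by (cases "q = 2") auto
  obtain g where g: "residue_primroot q g"
    using residue_primroot_odd_prime_power_exists[of q] assms power_one_right[of q]
    by (metis zero_less_one)
  have ord: "ord q g = q - 1" and cop: "coprime q g"
    using g assms(1) by (auto simp: residue_primroot_def totient_prime)
  have "Legendre (int g) (int q) \<noteq> 1"
  proof
    assume "Legendre (int g) (int q) = 1"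
    then have "[int (g ^ ((q - 1) div 2)) = int 1] (mod q)"
      using euler_criterion[of q "int g"] assms(1) \<open>2 < q\<close> by (simp add: cong_sym)
    then have "[g ^ ((q - 1) div 2) = 1] (mod q)"
      by (simp only: cong_int_iff)
    then have "q - 1 dvd (q - 1) div 2"
      unfolding ord[symmetric] by (simp only: ord_divides)
    then show False using \<open>2 < q\<close> by (auto dest: dvd_imp_le)
  qed
  moreover have "Legendre (int g) (int q) \<noteq> 0"
    using cop assms(1) by (auto simp: Legendre_eq_0_iff coprime_absorb_left)
  ultimately have "Legendre (int g) (int q) = -1"
    using Legendre_cases[of "int g" "int q"] by auto
  then show thesis by (rule that)
qed

lemma residues_mod_eq: "residues_mod q = {i \<in> {1..<q}. Legendre (int i) (int q) = 1}"
  by (auto simp: residues_mod_def Legendre_def cong_0_iff dest: nat_dvd_not_less)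

lemma nonresidues_mod_eq: "nonresidues_mod q = {i \<in> {1..<q}. Legendre (int i) (int q) = -1}"
  by (auto simp: nonresidues_mod_def Legendre_def cong_0_iff dest: nat_dvd_not_less)

lemma residues_mod_Un: "residues_mod q \<union> nonresidues_mod q = {1..<q}"
  by (auto simp: residues_mod_def nonresidues_mod_def)

lemma residues_mod_Int: "residues_mod q \<inter> nonresidues_mod q = {}"
  by (auto simp: residues_mod_def nonresidues_mod_def)

lemma finite_residues_mod [simp]: "finite (residues_mod q)" "finite (nonresidues_mod q)"
  by (simp_all add: residues_mod_def nonresidues_mod_def)

text \<open>Multiplication by \<open>k\<close> permutes the nonzero classes modulo \<open>q\<close>
  and multiplies their Legendre symbols by \<open>t\<close>. The element \<open>y\<close> is left
  general because powers of \<alpha>, of \<open>x_Rq\<close> and of the natural number 1 are all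
  summed this way.\<close>

lemma sum_Legendre_class:
  fixes y :: "'a::comm_semiring_1"
  assumes "prime q" "odd q" "y ^ q = 1" and t: "Legendre (int k) (int q) = t" "t \<noteq> 0"
  shows "(\<Sum>i | i \<in> {1..<q} \<and> Legendre (int i) (int q) = s. y ^ (k * i)) =
    (\<Sum>i | i \<in> {1..<q} \<and> Legendre (int i) (int q) = t * s. y ^ i)"
proof -
  have "coprime k q"
    using t assms(1) prime_imp_coprime[of q k]
    by (simp add: coprime_commute flip: Legendre_eq_0_iff)
  then obtain l where l: "[k * l = 1] (mod q)"
    using coprime_iff_invertible_nat[of k q] by auto
  have tt: "t * t = 1" using Legendre_cases[of k q] t by auto
  have leg: "Legendre (int (i mod q)) (int q) = Legendre (int i) (int q)" for i
    by (rule Legendre_cong) (simp add: cong_def zmod_int)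
  have legk: "Legendre (int (k * i)) (int q) = t * Legendre (int i) (int q)" for i
    using Legendre_mult[OF assms(1,2), of k i] t by simp
  have "Legendre (int (k * l)) (int q) = Legendre (int 1) (int q)"
    using l by (intro Legendre_cong) (simp only: cong_int_iff)
  also have "\<dots> = 1"
  proof -
    have "\<not> [1 = 0] (mod int q)"
      using assms(1) by (auto simp: cong_0_iff dest: zdvd_imp_le prime_gt_1_nat)
    moreover have "QuadRes (int q) 1"
      unfolding QuadRes_def by (rule exI[of _ 1]) simp
    ultimately show ?thesis by (simp add: Legendre_def)
  qed
  \<comment> \<open>The symbols of \<open>k\<close> and \<open>l\<close> multiply to 1 and
    \<open>t * t = 1\<close>, so the inverse \<open>l\<close> has the same symbol as
    \<open>k\<close>.\<close>
  finally have "Legendre (int l) (int q) = t" 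
    using legk[of l] tt by (metis mult.assoc mult.left_neutral mult.right_neutral)
  then have legl: "Legendre (int (l * i)) (int q) = t * Legendre (int i) (int q)" for i
    using Legendre_mult[OF assms(1,2), of l i] by simp
  have pos: "i mod q \<in> {1..<q}" if "Legendre (int i) (int q) \<noteq> 0" for i
    using that assms(1) by (auto simp: Legendre_eq_0_iff prime_gt_0_nat Suc_le_eq mod_greater_zero_iff_not_dvd)
  have kl: "k * (l * i mod q) mod q = i" "l * (k * i mod q) mod q = i" if "i \<in> {1..<q}" for i
  proof -
    have "k * l * i mod q = i"
      using cong_mult[OF l cong_refl[of i]] that by (simp add: cong_def)
    then show "k * (l * i mod q) mod q = i" "l * (k * i mod q) mod q = i"
      by (simp_all add: mod_mult_right_eq mult_ac)
  qed
  have *: "i \<in> {1..<q} \<Longrightarrow> Legendre (int i) (int q) \<noteq> 0" for i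
    by (auto simp: Legendre_eq_0_iff dest: nat_dvd_not_less)
  have tt': "t * (t * s) = s" using tt by (simp flip: mult.assoc)
  show ?thesis
  proof (rule sum.reindex_bij_witness[where i = "\<lambda>i. l * i mod q" and j = "\<lambda>i. k * i mod q"])
    fix i assume "i \<in> {i. i \<in> {1..<q} \<and> Legendre (int i) (int q) = s}"
    then have i: "i \<in> {1..<q}" "Legendre (int i) (int q) = s" by auto
    show "l * (k * i mod q) mod q = i" using kl i by simp
    show "k * i mod q \<in> {i. i \<in> {1..<q} \<and> Legendre (int i) (int q) = t * s}"
      using pos[of "k * i"] *[OF i(1)] t(2) i(2) legk[of i] leg[of "k * i"] by auto
    show "y ^ (k * i mod q) = y ^ (k * i)" by (rule power_mod_period[OF assms(3)])
  next
    fix i assume "i \<in> {i. i \<in> {1..<q} \<and> Legendre (int i) (int q) = t * s}"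
    then have i: "i \<in> {1..<q}" "Legendre (int i) (int q) = t * s" by auto
    show "k * (l * i mod q) mod q = i" using kl i by simp
    show "l * i mod q \<in> {i. i \<in> {1..<q} \<and> Legendre (int i) (int q) = s}"
      using pos[of "l * i"] *[OF i(1)] t(2) i(2) legl[of i] leg[of "l * i"] tt' by auto
  qed
qed

lemma sum_residues_mult:
  fixes y :: "'a::comm_semiring_1"
  assumes "prime q" "odd q" "y ^ q = 1" "Legendre (int k) (int q) = 1"
  shows "(\<Sum>i\<in>residues_mod q. y ^ (k * i)) = (\<Sum>i\<in>residues_mod q. y ^ i)"
    and "(\<Sum>i\<in>nonresidues_mod q. y ^ (k * i)) = (\<Sum>i\<in>nonresidues_mod q. y ^ i)"
  using sum_Legendre_class[OF assms, of 1] sum_Legendre_class[OF assms, of "-1"]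
  by (simp_all add: residues_mod_eq nonresidues_mod_eq)

lemma sum_nonresidues_mult:
  fixes y :: "'a::comm_semiring_1"
  assumes "prime q" "odd q" "y ^ q = 1" "Legendre (int k) (int q) = -1"
  shows "(\<Sum>i\<in>residues_mod q. y ^ (k * i)) = (\<Sum>i\<in>nonresidues_mod q. y ^ i)"
    and "(\<Sum>i\<in>nonresidues_mod q. y ^ (k * i)) = (\<Sum>i\<in>residues_mod q. y ^ i)"
  using sum_Legendre_class[OF assms, of 1] sum_Legendre_class[OF assms, of "-1"]
  by (simp_all add: residues_mod_eq nonresidues_mod_eq)

lemma card_residues_mod:
  assumes "prime q" "odd q"
  shows "card (residues_mod q) = (q - 1) div 2" "card (nonresidues_mod q) = (q - 1) div 2"
proof -
  obtain k where "Legendre (int k) (int q) = -1" by (rule nonresidue_exists[OF assms])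
  \<comment> \<open>At \<open>y = 1\<close> in the natural numbers, the exchanged sums are the two
    cardinalities.\<close>
  from sum_nonresidues_mult(1)[OF assms _ this, of "1 :: nat"]
  have "card (residues_mod q) = card (nonresidues_mod q)" by simp
  moreover have "card (residues_mod q) + card (nonresidues_mod q) = q - 1"
    by (simp add: residues_mod_Int residues_mod_Un flip: card_Un_disjoint)
  ultimately show "card (residues_mod q) = (q - 1) div 2" "card (nonresidues_mod q) = (q - 1) div 2"
    by simp_all
qed

text \<open>The polynomial \<open>y^p - y\<close> has at most \<open>p\<close> roots, and the
  \<open>p\<close> elements of the prime field are already roots by Fermat's little theorem.\<close>

lemma frobenius_fixed_imp_range_to_ac:
  fixes z :: "'p::prime_card mod_ring alg_closure"
  assumes "z ^ CARD('p) = z"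
  shows "z \<in> range to_ac"
proof -
  let ?p = "CARD('p)"
  let ?f = "monom 1 ?p - monom 1 1 :: 'p mod_ring alg_closure poly"
  have "1 < ?p" using prime_card prime_gt_1_nat by blast
  then have deg: "degree ?f = ?p" and "?f \<noteq> 0"
    using lead_coeff_monom_minus[of "monom 1 1 :: 'p mod_ring alg_closure poly" ?p]
    by (auto simp: degree_monom_eq)
  have roots: "poly ?f w = 0 \<longleftrightarrow> w ^ ?p = w" for w
    by (simp add: poly_monom)
  have fermat: "(a :: 'p mod_ring) ^ ?p = a" for a
  proof -
    obtain i where "a = of_nat i" using surj_of_nat_mod_ring by blast
    \<comment> \<open>Fermat's theorem by induction on \<open>i\<close>, the step being additivity
      of the \<open>p\<close>-th power.\<close>
    moreover have "(of_nat i :: 'p mod_ring) ^ ?p = of_nat i" for i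
      using prime_card[where 'a = 'p]
      by (induction i) (simp_all add: freshmans_dream power_0_left)
    ultimately show ?thesis by simp
  qed
  have "range to_ac \<subseteq> {w. poly ?f w = 0}"
    using fermat by (auto simp: poly_monom simp flip: to_ac_power)
  moreover have "card {w. poly ?f w = 0} \<le> card (range (to_ac :: 'p mod_ring \<Rightarrow> _))"
    using card_poly_roots_bound[OF \<open>?f \<noteq> 0\<close>] unfolding deg by (simp add: card_image inj_to_ac)
  ultimately have "range to_ac = {w. poly ?f w = 0}"
    by (intro card_seteq poly_roots_finite \<open>?f \<noteq> 0\<close>)
  then show ?thesis using assms roots by auto
qed

section \<open>Evaluation at the powers of a primitive root of unity\<close>

context comm_semiring_hom
begin

lemma eval_poly_mult: "eval_poly hom (f * g) x = eval_poly hom f x * eval_poly hom g x"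
proof -
  interpret map_poly_comm_semiring_hom hom ..
  show ?thesis by (simp add: eval_poly_def hom_distribs)
qed

end

context comm_ring_hom
begin

lemma eval_poly_diff: "eval_poly hom (f - g) x = eval_poly hom f x - eval_poly hom g x"
proof -
  interpret map_poly_comm_ring_hom hom ..
  show ?thesis by (simp add: eval_poly_def hom_distribs)
qed

end

interpretation to_ac: comm_ring_hom to_ac
  by unfold_locales simp_all

interpretation scalar: comm_ring_hom "\<lambda>a. scalar a :: ('p::prime_card, 'q::finite) Rq"
  by unfold_locales
    (simp_all add: const_R_add const_Rq_add const_R_mult const_Rq_mult)

text \<open>The common shape of \<open>h_Rq\<close> and the idempotents. As a polynomial over the
  prime field it can be evaluated both at \<open>x_Rq\<close> and at powers of \<alpha>.\<close>

definition qr_poly :: "nat \<Rightarrow> 'a \<Rightarrow> 'a \<Rightarrow> 'a \<Rightarrow> 'a::comm_semiring_1 poly"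
  where "qr_poly q a b c =
    monom a 0 + (\<Sum>i\<in>residues_mod q. monom b i) + (\<Sum>i\<in>nonresidues_mod q. monom c i)"

lemma coeff_qr_poly:
  "coeff (qr_poly q a b c) j = (if j = 0 then a else 0) +
    (if j \<in> residues_mod q then b else 0) + (if j \<in> nonresidues_mod q then c else 0)"
  by (simp add: qr_poly_def coeff_sum)

lemma (in comm_semiring_hom) eval_qr_poly:
  "eval_poly hom (qr_poly q a b c) y =
    hom a + hom b * (\<Sum>i\<in>residues_mod q. y ^ i) + hom c * (\<Sum>i\<in>nonresidues_mod q. y ^ i)"
  by (simp add: qr_poly_def eval_poly_sum eval_poly_monom sum_distrib_left)

text \<open>In terms of \<open>H + K\<close> and \<open>H - K\<close> the expression becomes
  \<open>1/2 - 1/2 * (H - K) / t\<close>. It is applied with \<open>n = q\<close>,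
  \<open>t = \<theta>\<close> and the two Gaussian periods in either order.\<close>

lemma idempotent_value:
  fixes n t H K :: "'a::field"
  assumes "(2::'a) \<noteq> 0" "n \<noteq> 0" "t \<noteq> 0" "H + K = -1"
  shows "H - K = t \<Longrightarrow> 1/2 * (1 - 1/n) + - (1/2 * (1/n + 1/t)) * H + - (1/2 * (1/n - 1/t)) * K = 0"
    and "K - H = t \<Longrightarrow> 1/2 * (1 - 1/n) + - (1/2 * (1/n + 1/t)) * H + - (1/2 * (1/n - 1/t)) * K = 1"
proof -
  have "a * (1 - u) + - (a * (u + v)) * H + - (a * (u - v)) * K =
      a * (1 - u) - a * u * (H + K) - a * v * (H - K)" for a u v
    by (simp add: algebra_simps)
  note * = this[of "1/2" "1/n" "1/t"]
  {
    assume "H - K = t"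
    then show "1/2 * (1 - 1/n) + - (1/2 * (1/n + 1/t)) * H + - (1/2 * (1/n - 1/t)) * K = 0"
      unfolding * assms(4) using assms(1-3) by (simp add: field_simps)
  next
    assume "K - H = t"
    then have "H - K = - t" by (metis minus_diff_eq)
    then show "1/2 * (1 - 1/n) + - (1/2 * (1/n + 1/t)) * H + - (1/2 * (1/n - 1/t)) * K = 1"
      unfolding * assms(4) using assms(1-3) by (simp add: field_simps)
  }
qed

section \<open>Gaussian periods, the Gauss sum and the values of the idempotent\<close>

locale quadratic_residue_root =
  fixes q :: nat and \<alpha> :: "'p::prime_card mod_ring alg_closure"
  assumes q: "prime q" "odd q"
    and p_residue: "Legendre (int CARD('p)) (int q) = 1"
    and p_odd: "CARD('p) \<noteq> 2"
    and \<alpha>: "primitive_root_of_unity q \<alpha>"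
begin

text \<open>\<open>H\<close> and \<open>K\<close> are the two quadratic Gaussian periods.\<close>

definition H :: "'p mod_ring alg_closure" where "H = (\<Sum>i\<in>residues_mod q. \<alpha> ^ i)"
definition K :: "'p mod_ring alg_closure" where "K = (\<Sum>i\<in>nonresidues_mod q. \<alpha> ^ i)"
definition \<theta> :: "'p mod_ring" where "\<theta> = gauss_sum q \<alpha>"

lemma q_gt_1: "1 < q"
  using q(1) by (rule prime_gt_1_nat)

lemma two_neq_0: "(2 :: 'p mod_ring) \<noteq> 0"
proof
  assume "(2 :: 'p mod_ring) = 0"
  then have "CARD('p) dvd 2" using of_nat_0_mod_ring_dvd[of 2, where 'a = 'p] by simp
  then show False using p_odd prime_card[where 'a = 'p] primes_dvd_imp_eq[of "CARD('p)" 2] by simp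
qed

lemma q_neq_0: "(of_nat q :: 'p mod_ring) \<noteq> 0"
proof
  assume "(of_nat q :: 'p mod_ring) = 0"
  then have "CARD('p) dvd q" by (rule of_nat_0_mod_ring_dvd)
  then have "CARD('p) = q" using q(1) prime_card[where 'a = 'p] by (intro primes_dvd_imp_eq)
  then show False using p_residue Legendre_eq_0_iff[of "CARD('p)" q] by simp
qed

lemma \<alpha>_power_q: "\<alpha> ^ q = 1" and \<alpha>_power_neq_1: "0 < k \<Longrightarrow> k < q \<Longrightarrow> \<alpha> ^ k \<noteq> 1"
  using \<alpha> by (auto simp: primitive_root_of_unity_def)

lemma inj_on_\<alpha>_power: "inj_on (\<lambda>k. \<alpha> ^ k) {..<q}"
proof (rule linorder_inj_onI)
  fix i j :: nat assume ij: "i < j" "i \<in> {..<q}" "j \<in> {..<q}"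
  have "\<alpha> \<noteq> 0" using \<alpha>_power_q q_gt_1 by (auto simp: power_0_left)
  show "\<alpha> ^ i \<noteq> \<alpha> ^ j"
  proof
    assume "\<alpha> ^ i = \<alpha> ^ j"
    also have "\<alpha> ^ j = \<alpha> ^ i * \<alpha> ^ (j - i)" using ij by (simp flip: power_add)
    finally have "\<alpha> ^ (j - i) = 1" using \<open>\<alpha> \<noteq> 0\<close> by simp
    then show False using \<alpha>_power_neq_1[of "j - i"] ij by (simp add: less_imp_diff_less)
  qed
qed auto

text \<open>The powers of \<alpha> are \<open>q\<close> distinct roots, more than the degree
  allows.\<close>

lemma vanishing_poly_eq_0:
  assumes "degree f < q" "\<And>k. k < q \<Longrightarrow> poly f (\<alpha> ^ k) = 0"
  shows "f = 0"
proof (rule ccontr)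
  assume "f \<noteq> 0"
  have "q = card ((\<lambda>k. \<alpha> ^ k) ` {..<q})"
    by (simp add: card_image inj_on_\<alpha>_power)
  also have "\<dots> \<le> card {x. poly f x = 0}"
    by (rule card_mono) (use assms(2) \<open>f \<noteq> 0\<close> in \<open>auto intro: poly_roots_finite\<close>)
  also have "\<dots> \<le> degree f"
    using \<open>f \<noteq> 0\<close> by (rule card_poly_roots_bound)
  finally show False using assms(1) by simp
qed

text \<open>The transfer principle: an identity in \<open>Rq\<close> between polynomials in
  \<open>x\<close> over the prime field may be checked at the powers of \<alpha>. The remainder of
  \<open>f\<close> modulo \<open>x^q - 1\<close> has \<open>q\<close> roots, so it is zero, and
  \<open>x_Rq\<close> annihilates the modulus.\<close>

lemma eval_x_Rq_eq_0:
  assumes "q = CARD('q::finite)" "\<And>k. k < q \<Longrightarrow> eval_poly to_ac f (\<alpha> ^ k) = 0"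
  shows "eval_poly scalar f (x_Rq :: ('p, 'q) Rq) = 0"
proof -
  let ?m = "monom 1 q - 1 :: 'p mod_ring poly"
  have deg: "degree ?m = q" and "?m \<noteq> 0"
    using lead_coeff_monom_minus[of "1 :: 'p mod_ring poly" q] q_gt_1 by auto
  have f: "f = ?m * (f div ?m) + f mod ?m" by simp
  have m_ac: "eval_poly to_ac ?m (\<alpha> ^ k) = 0" for k
  proof -
    have "(\<alpha> ^ k) ^ q = (\<alpha> ^ q) ^ k" by (simp add: mult.commute flip: power_mult)
    then show ?thesis
      by (simp add: \<alpha>_power_q to_ac.eval_poly_diff to_ac.eval_poly_monom flip: monom_eq_1)
  qed
  have "poly (map_poly to_ac (f mod ?m)) (\<alpha> ^ k) = 0" if "k < q" for k
  proof -
    have "eval_poly to_ac f (\<alpha> ^ k) =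
        eval_poly to_ac ?m (\<alpha> ^ k) * eval_poly to_ac (f div ?m) (\<alpha> ^ k) +
        eval_poly to_ac (f mod ?m) (\<alpha> ^ k)"
      by (subst f) (simp only: to_ac.eval_poly_add to_ac.eval_poly_mult)
    then show ?thesis using m_ac assms(2)[OF that] by (simp add: eval_poly_def)
  qed
  moreover have "degree (f mod ?m) < q"
    using degree_mod_less[OF \<open>?m \<noteq> 0\<close>, of f] q_gt_1 by (auto simp: deg)
  then have "degree (map_poly to_ac (f mod ?m)) < q"
    using degree_map_poly_le le_less_trans by blast
  ultimately have "map_poly to_ac (f mod ?m) = 0"
    by (intro vanishing_poly_eq_0)
  then have "f mod ?m = 0"
    by (simp add: poly_eq_iff coeff_map_poly)
  then have "f = ?m * (f div ?m)" using f by simp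
  moreover have "eval_poly scalar ?m (x_Rq :: ('p, 'q) Rq) = 0"
    using x_Rq_power_card[where 'p = 'p and 'q = 'q] assms(1)
    by (simp add: scalar.eval_poly_diff scalar.eval_poly_monom flip: monom_eq_1)
  ultimately show ?thesis
    using scalar.eval_poly_mult[of ?m "f div ?m" "x_Rq :: ('p, 'q) Rq"] by simp
qed

lemma residues_insert: "{..<q} = insert 0 (residues_mod q \<union> nonresidues_mod q)"
  using q_gt_1 by (auto simp: residues_mod_Un)

lemma sum_split: "(\<Sum>i<q. f i) = f 0 + (\<Sum>i\<in>residues_mod q. f i) + (\<Sum>i\<in>nonresidues_mod q. f i)"
  for f :: "nat \<Rightarrow> 'a::comm_monoid_add"
proof -
  have "0 \<notin> residues_mod q \<union> nonresidues_mod q" unfolding residues_mod_Un by simp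
  then show ?thesis
    unfolding residues_insert
    by (simp add: sum.union_disjoint residues_mod_Int add.assoc)
qed

lemma H_plus_K: "H + K = -1"
proof -
  have "(\<alpha> - 1) * (\<Sum>i<q. \<alpha> ^ i) = 0"
    using \<alpha>_power_q by (simp flip: power_diff_1_eq)
  moreover have "\<alpha> \<noteq> 1" using \<alpha>_power_neq_1[of 1] q_gt_1 by simp
  ultimately have "1 + (H + K) = 0" by (simp add: sum_split H_def K_def add.assoc)
  then show ?thesis by (simp add: add_eq_0_iff)
qed

text \<open>The Legendre symbol of \<open>k\<close> decides: a residue keeps the two periods, a
  nonresidue swaps them.\<close>

lemma root_values:
  assumes "0 < k" "k < q"
  shows "(\<Sum>i\<in>residues_mod q. (\<alpha> ^ k) ^ i) = H \<and> (\<Sum>i\<in>nonresidues_mod q. (\<alpha> ^ k) ^ i) = K \<or>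
    (\<Sum>i\<in>residues_mod q. (\<alpha> ^ k) ^ i) = K \<and> (\<Sum>i\<in>nonresidues_mod q. (\<alpha> ^ k) ^ i) = H"
proof -
  have "Legendre (int k) (int q) \<noteq> 0"
    using assms by (auto simp: Legendre_eq_0_iff dest: nat_dvd_not_less)
  then have "Legendre (int k) (int q) = 1 \<or> Legendre (int k) (int q) = -1"
    using Legendre_cases[of k q] by auto
  then show ?thesis
    using sum_residues_mult[OF q \<alpha>_power_q, of k] sum_nonresidues_mult[OF q \<alpha>_power_q, of k]
    by (auto simp: H_def K_def simp flip: power_mult)
qed

text \<open>Raising a period to the power \<open>p\<close> multiplies every exponent by
  \<open>p\<close>. As \<open>p\<close> is a residue modulo \<open>q\<close>, this permutes the
  terms, so the periods are fixed by Frobenius.\<close>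

lemma H_in_range: "H \<in> range to_ac" and K_in_range: "K \<in> range to_ac"
proof -
  have char: "prime CHAR('p mod_ring alg_closure)" "CARD('p) = CHAR('p mod_ring alg_closure)"
    using prime_card[where 'a = 'p] by simp_all
  have "H ^ CARD('p) = H" "K ^ CARD('p) = K"
    using sum_residues_mult[OF q \<alpha>_power_q p_residue]
    by (simp_all only: H_def K_def freshmans_dream_sum[OF char])
      (simp_all add: mult.commute flip: power_mult)
  then show "H \<in> range to_ac" "K \<in> range to_ac"
    by (simp_all add: frobenius_fixed_imp_range_to_ac)
qed

lemma to_ac_\<theta>: "to_ac \<theta> = H - K"
proof -
  obtain a b where ab: "H = to_ac a" "K = to_ac b" using H_in_range K_in_range by blast
  have "{1..q-1} = residues_mod q \<union> nonresidues_mod q"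
    unfolding residues_mod_Un using q_gt_1 by auto
  then have "(\<Sum>i=1..q-1. of_int (Legendre (int i) (int q)) * \<alpha> ^ i) =
      (\<Sum>i\<in>residues_mod q. of_int (Legendre (int i) (int q)) * \<alpha> ^ i) +
      (\<Sum>i\<in>nonresidues_mod q. of_int (Legendre (int i) (int q)) * \<alpha> ^ i)"
    by (simp only: sum.union_disjoint finite_residues_mod residues_mod_Int)
  also have "\<dots> = H - K"
    by (simp add: H_def K_def residues_mod_eq nonresidues_mod_eq sum_negf)
  \<comment> \<open>\<open>of_ac\<close> undoes \<open>to_ac\<close> only on the prime field, so the
    Gauss sum must first be exhibited as an image.\<close>
  also have "\<dots> = to_ac (a - b)" by (simp add: ab)
  finally show ?thesis
    unfolding \<theta>_def gauss_sum_def by (simp only: of_ac_to_ac) (simp only: to_ac_diff ab)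
qed

text \<open>If the periods agreed, the polynomial whose coefficients are the Legendre symbols would
  vanish at all powers of \<alpha>. At 1 it does so because both classes have equal size. Its degree
  is below \<open>q\<close>, yet its coefficient at index 1 is 1.\<close>

lemma \<theta>_neq_0: "\<theta> \<noteq> 0"
proof
  assume "\<theta> = 0"
  then have "H = K" using to_ac_\<theta> by simp
  let ?f = "map_poly to_ac (qr_poly q 0 1 (-1) :: 'p mod_ring poly)"
  have coeff: "coeff ?f i =
      (if i \<in> residues_mod q then 1 else if i \<in> nonresidues_mod q then -1 else 0)" for i
    using residues_mod_Int[of q] by (auto simp: coeff_map_poly coeff_qr_poly)
  have eval: "poly ?f y = (\<Sum>i\<in>residues_mod q. y ^ i) - (\<Sum>i\<in>nonresidues_mod q. y ^ i)" for y
    using to_ac.eval_qr_poly[of q 0 1 "-1" y] by (simp add: eval_poly_def)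
  have "degree ?f < q"
  proof (rule degree_lessI)
    show "?f \<noteq> 0 \<or> 0 < q" using q_gt_1 by simp
    have "k \<notin> residues_mod q \<and> k \<notin> nonresidues_mod q" if "q \<le> k" for k
      using that by (auto simp: residues_mod_def nonresidues_mod_def)
    then show "\<forall>k\<ge>q. coeff ?f k = 0" unfolding coeff by simp
  qed
  moreover have "poly ?f (\<alpha> ^ k) = 0" if "k < q" for k
  proof (cases "k = 0")
    case True
    then show ?thesis unfolding eval by (simp add: card_residues_mod[OF q])
  next
    case False
    then show ?thesis unfolding eval using root_values[of k] \<open>k < q\<close> \<open>H = K\<close> by auto
  qed
  ultimately have f: "?f = 0" by (rule vanishing_poly_eq_0)
  moreover have "1 \<in> residues_mod q"
    using q_gt_1 by (auto simp: residues_mod_def QuadRes_def intro: exI[of _ 1])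
  ultimately show False using coeff[of 1] unfolding f by simp
qed


text \<open>The polynomial that yields \<open>e1_tilde \<theta>\<close> when evaluated at
  \<open>x_Rq\<close>.\<close>

definition E :: "'p mod_ring poly" where
  "E = qr_poly q (1/2 * (1 - 1/of_nat q))
    (- (1/2 * (1/of_nat q + 1/\<theta>))) (- (1/2 * (1/of_nat q - 1/\<theta>)))"

text \<open>The value is 0 at \<open>k = 0\<close> and at residues, and 1 at nonresidues. The value
  at \<open>k = 0\<close> is singled out because it gives orthogonality to
  \<open>h_Rq\<close>.\<close>

lemma eval_E:
  assumes "k < q"
  shows "eval_poly to_ac E (\<alpha> ^ k) \<in> {0, 1}" and "k = 0 \<Longrightarrow> eval_poly to_ac E (\<alpha> ^ k) = 0"
proof -
  let ?n = "of_nat q :: 'p mod_ring alg_closure" and ?t = "to_ac \<theta>"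
  let ?v = "\<lambda>y z. 1/2 * (1 - 1/?n) + - (1/2 * (1/?n + 1/?t)) * y + - (1/2 * (1/?n - 1/?t)) * z"
  have E: "eval_poly to_ac E y =
      ?v (\<Sum>i\<in>residues_mod q. y ^ i) (\<Sum>i\<in>nonresidues_mod q. y ^ i)" for y
    unfolding E_def to_ac.eval_qr_poly by simp
  have ac_two: "(2 :: 'p mod_ring alg_closure) \<noteq> 0"
    using two_neq_0 to_ac_eq_0_iff[of "2 :: 'p mod_ring"] by simp
  have n: "?n \<noteq> 0"
    using q_neq_0 to_ac_eq_0_iff[of "of_nat q :: 'p mod_ring"] by simp
  have t: "?t \<noteq> 0" using \<theta>_neq_0 by simp
  have KH: "K + H = -1" using H_plus_K by (simp add: add.commute)
  have v: "?v H K = 0" "?v K H = 1"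
    using idempotent_value(1)[OF ac_two n t H_plus_K] idempotent_value(2)[OF ac_two n t KH]
      to_ac_\<theta> by simp_all
  show zero: "eval_poly to_ac E (\<alpha> ^ k) = 0" if "k = 0"
  proof -
    let ?m = "of_nat ((q - 1) div 2) :: 'p mod_ring alg_closure"
    \<comment> \<open>At 1 both sums equal \<open>(q - 1) div 2\<close>, so the terms in
      \<open>1/\<theta>\<close> cancel and the rest is a multiple of
      \<open>1 - 1/q * q\<close>.\<close>
    have "q = 2 * ((q - 1) div 2) + 1" using q(2) by presburger
    then have m: "?n = 2 * ?m + 1"
      by (metis of_nat_1 of_nat_add of_nat_mult of_nat_numeral)
    have "a * (1 - u) + - (a * (u + v)) * ?m + - (a * (u - v)) * ?m = a * (1 - u * (2 * ?m + 1))"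
      for a u v by (simp add: algebra_simps)
    from this[of "1/2" "1/?n" "1/?t"] have "?v ?m ?m = 1/2 * (1 - 1/?n * ?n)"
      by (simp only: m)
    then show ?thesis
      using n that by (simp add: E card_residues_mod[OF q])
  qed
  show "eval_poly to_ac E (\<alpha> ^ k) \<in> {0, 1}"
  proof (cases "k = 0")
    case False
    then show ?thesis using root_values[of k] assms v unfolding E by auto
  qed (use zero in simp)
qed

end

lemma x_Rq_mult_h_Rq:
  "x_Rq * (h_Rq :: ('p::prime_card, 'q::finite) Rq) = h_Rq"
  if "1 < CARD('q)"
proof -
  have "{..<CARD('q)} = insert 0 (residues_mod CARD('q) \<union> nonresidues_mod CARD('q))"
    using that by (auto simp: residues_mod_Un)
  moreover have "0 \<notin> residues_mod CARD('q) \<union> nonresidues_mod CARD('q)"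
    unfolding residues_mod_Un by simp
  ultimately have h: "h_Rq = (\<Sum>i<CARD('q). x_Rq ^ i :: ('p, 'q) Rq)"
    by (simp add: h_Rq_def j1_def j2_def sum.union_disjoint residues_mod_Int add.assoc)
  \<comment> \<open>\<open>h_Rq\<close> is the full geometric sum, so the product is
    \<open>x^q - 1\<close>.\<close>
  have "(x_Rq - 1) * h_Rq = (0 :: ('p, 'q) Rq)"
    unfolding h power_diff_1_eq[symmetric] by (simp add: x_Rq_power_card)
  then show ?thesis by (simp add: algebra_simps)
qed

section \<open>Code generators\<close>

lemma complementary_ideals:
  fixes a b h :: "'a::comm_ring_1"
  assumes "a * a = a" "b * b = b" "h * h = h" "a * b = 0" "a * h = 0" "b * h = 0" "a + b + h = 1"
  shows "ideal_gen (a + h) \<inter> ideal_gen (b + h) = ideal_gen h"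
    and "ideal_gen (a + h) + ideal_gen (b + h) = UNIV"
    and "ideal_gen a \<inter> ideal_gen b = {0}"
    and "ideal_gen a + ideal_gen b = ideal_gen (1 - h)"
    and "ideal_gen a \<inter> ideal_gen h = {0}"
    and "ideal_gen a + ideal_gen h = ideal_gen (a + h)"
proof -
  have ha: "h * a = 0" "h * b = 0" using assms by (simp_all add: mult.commute)
  have ah: "(a + h) * (a + h) = a + h" "(b + h) * (b + h) = b + h" "(a + h) * (b + h) = h"
    by (simp_all add: distrib_left distrib_right assms ha)
  then show "ideal_gen (a + h) \<inter> ideal_gen (b + h) = ideal_gen h"
    by (simp add: ideal_gen_inter)
  show "ideal_gen (a + h) + ideal_gen (b + h) = UNIV"
  proof (intro equalityI subset_UNIV subsetI)
    fix z
    \<comment> \<open>The two ideals share \<open>h\<close>, so \<open>ideal_gen_sum\<close> does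
      not apply. Multiplying \<open>b + h\<close> by \<open>b\<close> removes the duplicate
      \<open>h\<close> and leaves \<open>a + h + b = 1\<close>.\<close>
    have "z * (a + h) + z * b * (b + h) = z * (a + h + (b * b + b * h))"
      by (simp add: algebra_simps)
    also have "\<dots> = z * (a + b + h)" by (simp add: assms(2,6) add_ac)
    finally have "z = z * (a + h) + z * b * (b + h)" by (simp add: assms(7))
    then show "z \<in> ideal_gen (a + h) + ideal_gen (b + h)"
      using set_plus_intro[of "z * (a + h)" "ideal_gen (a + h)" "z * b * (b + h)" "ideal_gen (b + h)"]
      by (auto simp: in_ideal_gen)
  qed
  show "ideal_gen a \<inter> ideal_gen b = {0}" "ideal_gen a \<inter> ideal_gen h = {0}"
    by (simp_all add: ideal_gen_inter assms ideal_gen_0)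
  have "a + b = 1 - h" using assms(7) by (simp add: algebra_simps)
  then show "ideal_gen a + ideal_gen b = ideal_gen (1 - h)"
    by (simp add: ideal_gen_sum assms)
  show "ideal_gen a + ideal_gen h = ideal_gen (a + h)"
    by (simp add: ideal_gen_sum assms)
qed

text \<open>The idempotent \<open>c\<close> splits the ring into two factors: \<open>(a, b)\<close>
  is \<open>(g, f)\<close> on the one where \<open>c = 1\<close> and \<open>(f, g)\<close> on the
  other. The form of \<open>b\<close> is that of \<open>a\<close> with \<open>1 - c\<close> for
  \<open>c\<close>.\<close>

lemma complementary_mixtures:
  fixes c f g h :: "'a::comm_ring_1"
  assumes c: "c * c = c"
    and "f * f = f" "g * g = g" "f * g = 0" "f * h = 0" "g * h = 0"
  defines "a \<equiv> (1 - c) * f + c * g" and "b \<equiv> (1 - (1 - c)) * f + (1 - c) * g"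
  shows "a * a = a" "b * b = b" "a * b = 0" "a * h = 0" "b * h = 0" "a + b = f + g"
proof -
  have gf: "g * f = 0" using assms by (simp add: mult.commute)
  have cc: "c * (c * z) = c * z" for z
    using c by (simp flip: mult.assoc)
  have fc: "f * c = c * f" "g * c = c * g" "f * (c * z) = c * (f * z)" "g * (c * z) = c * (g * z)" for z
    by (simp_all only: mult.commute[of _ c] mult.left_commute[of _ c])
  show "a * a = a" "b * b = b" "a * b = 0" "a * h = 0" "b * h = 0" "a + b = f + g"
    unfolding a_def b_def
    by (simp_all add: distrib_left distrib_right left_diff_distrib right_diff_distrib mult.assoc
        cc fc gf assms(1-6))
qed

text \<open>The coefficient of the second element in the generator, the first one carrying the
  complement. Thus all fourteen generators take one form, and partner codes have complementary
  coefficients.\<close>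

definition code_coeff :: "'p::prime_card mod_ring \<Rightarrow> nat \<Rightarrow> 'p R"
  where "code_coeff \<xi> k =
    (if k \<in> {1..4} then eta \<xi> k
     else if k \<in> {5..8} then 1 - eta \<xi> (k - 4)
     else if k \<in> {9..11} then 1 - (eta \<xi> 1 + eta \<xi> (k - 7))
     else eta \<xi> 1 + eta \<xi> (k - 10))"

lemma code_generator_eq:
  assumes "k \<in> {1..14}"
  shows "code_generator \<xi> a b k =
    (1 - const_Rq (code_coeff \<xi> k)) * a + const_Rq (code_coeff \<xi> k) * b"
  using assms
  by (auto simp: code_generator_def code_coeff_def Let_def const_Rq_add const_Rq_diff
      add.commute diff_diff_eq)

lemma code_coeff_partner:
  "k \<in> {1..4} \<Longrightarrow> code_coeff \<xi> (k + 4) = 1 - code_coeff \<xi> k"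
  "k \<in> {9..11} \<Longrightarrow> code_coeff \<xi> (k + 3) = 1 - code_coeff \<xi> k"
  by (auto simp: code_coeff_def)

lemma u_R_powers:
  "u_R * (u_R * (u_R * u_R)) = (u_R :: 'p::prime_card R)"
  "u_R * (u_R * (u_R * (u_R * z))) = u_R * (z :: 'p R)"
proof -
  show u: "u_R * (u_R * (u_R * u_R)) = (u_R :: 'p R)"
    using u_R_power4[where 'p = 'p] by (simp add: numeral_eq_Suc mult.assoc)
  show "u_R * (u_R * (u_R * (u_R * z))) = u_R * z"
    by (subst (5) u[symmetric]) (simp only: mult.assoc)
qed

lemma const_R_3: "const_R 3 = (3 :: 'p::prime_card R)"
proof -
  have "const_R (1 + 1 + 1) = (1 + 1 + 1 :: 'p R)"
    by (simp only: const_R_add const_R_1)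
  then show ?thesis by simp
qed

text \<open>With \<open>c = 1/3\<close> and \<open>z\<close> equal to 1, \<xi> and
  \<open>\<xi>^2\<close>, this covers the second to fourth eta at once. Without the factor
  \<open>c\<close>, the sum squares to three times itself because exponents of \<open>z\<close> and
  \<open>u\<close> reduce modulo 3.\<close>

lemma cubic_idempotent:
  fixes c z :: "'a::comm_ring_1"
  assumes "3 * c = 1" "z ^ 3 = 1" "u ^ 4 = u"
  defines "t \<equiv> c * (z * u + z ^ 2 * u ^ 2 + u ^ 3)"
  shows "t * t = t" and "(1 - u ^ 3) * t = 0"
proof -
  have z: "z * (z * z) = 1" using assms(2) by (simp add: power3_eq_cube mult.assoc)
  then have z': "z * (z * (z * w)) = w" for w by (simp flip: mult.assoc)
  have u: "u * (u * (u * u)) = u" using assms(3) by (simp add: numeral_eq_Suc)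
  then have u': "u * (u * (u * (u * w))) = u * w" for w by (simp flip: mult.assoc)
  define s where "s = z * u + z ^ 2 * u ^ 2 + u ^ 3"
  have "s * s = s + s + s"
    unfolding s_def power2_eq_square power3_eq_cube by (simp add: algebra_simps z z' u u')
  also have "\<dots> = 3 * s" by simp
  finally have "s * s = 3 * s" .
  then have "t * t = 3 * c * (c * s)"
    unfolding t_def s_def[symmetric] by (simp add: algebra_simps)
  then show "t * t = t" by (simp add: assms(1) t_def s_def)
  have "(1 - u ^ 3) * s = 0"
    unfolding s_def power2_eq_square power3_eq_cube by (simp add: algebra_simps u u')
  then show "(1 - u ^ 3) * t = 0"
    unfolding t_def s_def[symmetric] mult.left_commute[of _ c] by simp
qed

lemma eta_idempotent:
  assumes \<xi>: "\<xi> ^ 3 = 1" and three: "(3 :: 'p::prime_card mod_ring) \<noteq> 0" and "i \<in> {1..4}"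
  shows "eta \<xi> i * eta \<xi> i = (eta \<xi> i :: 'p R)"
    and "i \<noteq> 1 \<Longrightarrow> eta \<xi> 1 * eta \<xi> i = (0 :: 'p R)"
proof -
  have c: "3 * const_R (1 / 3) = (1 :: 'p R)"
    using three by (simp flip: const_R_3 const_R_mult)
  have x: "const_R \<xi> ^ 3 = (1 :: 'p R)" "const_R (\<xi> ^ 2) ^ 3 = (1 :: 'p R)"
  proof -
    have "(\<xi> ^ 2) ^ 3 = (\<xi> ^ 3) ^ 2" by (simp add: mult.commute flip: power_mult)
    then show "const_R \<xi> ^ 3 = (1 :: 'p R)" "const_R (\<xi> ^ 2) ^ 3 = (1 :: 'p R)"
      using \<xi> by (simp_all flip: const_R_power)
  qed
  have x2: "const_R (\<xi> ^ 2) ^ 2 = (const_R \<xi> :: 'p R)"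
  proof -
    have "(\<xi> ^ 2) ^ 2 = \<xi> ^ 3 * \<xi>" by (simp add: numeral_eq_Suc)
    then show ?thesis using \<xi> by (simp flip: const_R_power)
  qed
  note one = cubic_idempotent[OF c power_one u_R_power4]
  note xi = cubic_idempotent[OF c x(1) u_R_power4, folded const_R_power]
  \<comment> \<open>For \<open>z = \<xi>^2\<close> the square \<open>z^2 = \<xi>^4\<close> collapses
    to \<xi>.\<close>
  note xi2 = cubic_idempotent[OF c x(2) u_R_power4, unfolded x2]
  have u: "(1 - u_R ^ 3) * (1 - u_R ^ 3) = (1 - u_R ^ 3 :: 'p R)"
    by (simp add: algebra_simps power3_eq_cube u_R_powers)
  have "i = 1 \<or> i = 2 \<or> i = 3 \<or> i = 4" using assms(3) by auto
  then show "eta \<xi> i * eta \<xi> i = (eta \<xi> i :: 'p R)"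
    "i \<noteq> 1 \<Longrightarrow> eta \<xi> 1 * eta \<xi> i = (0 :: 'p R)"
    using u one xi xi2 by (auto simp: eta_def)
qed

lemma code_coeff_idempotent:
  assumes \<xi>: "\<xi> ^ 3 = 1" and three: "(3 :: 'p::prime_card mod_ring) \<noteq> 0" and "k \<in> {1..14}"
  shows "code_coeff \<xi> k * code_coeff \<xi> k = (code_coeff \<xi> k :: 'p R)"
proof -
  have sum: "(a + b) * (a + b) = a + b" if "a * a = a" "b * b = b" "a * b = 0" for a b :: "'p R"
    using that by (simp add: algebra_simps)
  have compl: "(1 - a) * (1 - a) = 1 - a" if "a * a = a" for a :: "'p R"
    using that by (simp add: algebra_simps)
  note eta = eta_idempotent[OF \<xi> three]
  have "k \<in> {1..4} \<or> k \<in> {5..8} \<or> k \<in> {9..11} \<or> k \<in> {12..14}" using assms(3) by auto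
  then consider "k \<in> {1..4}" | "k \<in> {5..8}" | "k \<in> {9..11}" | "k \<in> {12..14}" by blast
  then show ?thesis
  proof cases
    case 3
    then have "code_coeff \<xi> k = 1 - (eta \<xi> 1 + eta \<xi> (k - 7))" by (simp add: code_coeff_def)
    moreover have "k - 7 \<in> {1..4}" "k - 7 \<noteq> 1" using 3 by auto
    then have "(eta \<xi> 1 + eta \<xi> (k - 7)) * (eta \<xi> 1 + eta \<xi> (k - 7)) = (eta \<xi> 1 + eta \<xi> (k - 7) :: 'p R)"
      by (intro sum eta) auto
    ultimately show ?thesis by (simp only: compl)
  next
    case 4
    then have "code_coeff \<xi> k = eta \<xi> 1 + eta \<xi> (k - 10)" by (simp add: code_coeff_def)
    moreover have "k - 10 \<in> {1..4}" "k - 10 \<noteq> 1" using 4 by auto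
    then have "(eta \<xi> 1 + eta \<xi> (k - 10)) * (eta \<xi> 1 + eta \<xi> (k - 10)) = (eta \<xi> 1 + eta \<xi> (k - 10) :: 'p R)"
      by (intro sum eta) auto
    ultimately show ?thesis by simp
  next
    case 2
    then have "code_coeff \<xi> k = 1 - eta \<xi> (k - 4)" by (simp add: code_coeff_def)
    moreover have "k - 4 \<in> {1..4}" using 2 by auto
    then have "eta \<xi> (k - 4) * eta \<xi> (k - 4) = (eta \<xi> (k - 4) :: 'p R)" by (rule eta)
    ultimately show ?thesis by (simp only: compl)
  qed (simp add: code_coeff_def eta)
qed

lemma scalar_ring:
  "scalar (a + b) = (scalar a + scalar b :: ('p::prime_card, 'q::finite) Rq)"
  "scalar (a - b) = (scalar a - scalar b :: ('p, 'q) Rq)"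
  by (simp_all add: const_R_add const_Rq_add const_R_diff const_Rq_diff)

text \<open>Because \<open>x\<close> acts trivially on \<open>g\<close>, every multiple of
  \<open>g\<close> is a constant multiple; distinct constants give distinct multiples, so the ideal
  has as many elements as \<open>R\<close>.\<close>

lemma card_ideal_gen_h:
  fixes g :: "('p::prime_card, 'q::finite) Rq"
  assumes "x_Rq * g = g" and "\<And>r. const_Rq r * g = 0 \<Longrightarrow> r = 0"
  shows "card (ideal_gen g) = CARD('p) ^ 4"
proof -
  have pow: "x_Rq ^ i * g = g" for i
    by (induction i) (simp_all add: assms(1) mult.assoc)
  have "inj (\<lambda>r. const_Rq r * g)"
  proof (rule injI)
    fix r s assume "const_Rq r * g = const_Rq s * g"
    then have "const_Rq (r - s) * g = 0" by (simp add: const_Rq_diff left_diff_distrib)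
    then show "r = s" using assms(2) by fastforce
  qed
  moreover have "range (\<lambda>r. const_Rq r * g) = ideal_gen g"
  proof (intro equalityI subsetI)
    fix z assume "z \<in> ideal_gen g"
    then obtain r where "z = r * g" by (auto simp: in_ideal_gen)
    moreover obtain a where "r = word_Rq a" by (rule word_Rq_surj)
    ultimately have "z = const_Rq (\<Sum>i<CARD('q). a i) * g"
      by (simp add: word_Rq_def const_Rq_sum sum_distrib_right mult.assoc pow)
    then show "z \<in> range (\<lambda>r. const_Rq r * g)" by blast
  qed (auto simp: in_ideal_gen)
  ultimately have "bij_betw (\<lambda>r. const_Rq r * g) UNIV (ideal_gen g)"
    by (rule bij_betw_imageI)
  then show ?thesis by (simp add: card_R flip: bij_betw_same_card)
qed

section \<open>Orthogonal idempotents in \<open>Rq\<close> and the codes they generate\<close>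

context quadratic_residue_root
begin

context
  assumes q_card: "q = CARD('q::finite)"
begin

abbreviation hq :: "('p, 'q) Rq" where "hq \<equiv> scalar (1 / of_nat q) * h_Rq"

lemma e1_tilde_eval: "(e1_tilde \<theta> :: ('p, 'q) Rq) = eval_poly scalar E x_Rq"
  unfolding E_def scalar.eval_qr_poly e1_tilde_def Let_def j1_def j2_def q_card[symmetric]
  by (simp add: scalar.hom_uminus)

lemma h_Rq_eval: "(h_Rq :: ('p, 'q) Rq) = eval_poly scalar (qr_poly q 1 1 1) x_Rq"
  unfolding scalar.eval_qr_poly h_Rq_def j1_def j2_def q_card[symmetric] by simp

lemma e1_tilde_idem: "e1_tilde \<theta> * e1_tilde \<theta> = (e1_tilde \<theta> :: ('p, 'q) Rq)"
proof -
  \<comment> \<open>\<open>E\<close> takes only the values 0 and 1 at powers of \<alpha>.\<close>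
  have "eval_poly scalar (E * E - E) (x_Rq :: ('p, 'q) Rq) = 0"
    using eval_E(1) by (intro eval_x_Rq_eq_0 q_card)
      (auto simp: to_ac.eval_poly_diff to_ac.eval_poly_mult)
  then show ?thesis
    by (simp add: e1_tilde_eval scalar.eval_poly_diff scalar.eval_poly_mult)
qed

lemma e1_tilde_h: "e1_tilde \<theta> * h_Rq = (0 :: ('p, 'q) Rq)"
proof -
  \<comment> \<open>At each power one factor vanishes: \<open>E\<close> for \<open>k = 0\<close>,
    and otherwise the polynomial of \<open>h_Rq\<close>, whose value is
    \<open>1 + H + K\<close>.\<close>
  have "eval_poly to_ac (E * qr_poly q 1 1 1) (\<alpha> ^ k) = 0" if "k < q" for k
  proof (cases "k = 0")
    case True
    then show ?thesis using eval_E(2)[OF that] by (simp add: to_ac.eval_poly_mult)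
  next
    case False
    then have "eval_poly to_ac (qr_poly q 1 1 1) (\<alpha> ^ k) = 0"
      using root_values[of k] that H_plus_K
      unfolding to_ac.eval_qr_poly by (auto simp: add.assoc add.commute[of K])
    then show ?thesis by (simp add: to_ac.eval_poly_mult)
  qed
  then have "eval_poly scalar (E * qr_poly q 1 1 1) (x_Rq :: ('p, 'q) Rq) = 0"
    by (intro eval_x_Rq_eq_0 q_card)
  then show ?thesis
    by (simp add: e1_tilde_eval h_Rq_eval scalar.eval_poly_mult)
qed

lemma x_h: "x_Rq * hq = hq"
  using x_Rq_mult_h_Rq[where 'p = 'p and 'q = 'q] q_gt_1 q_card
  by (simp only: mult.left_commute[of x_Rq "scalar _"])

lemma h_idem: "hq * hq = hq"
proof -
  \<comment> \<open>Each of the \<open>q\<close> powers in \<open>h_Rq\<close> fixes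
    \<open>h_Rq\<close>, so its square is \<open>q\<close> times itself.\<close>
  have "x_Rq ^ i * h_Rq = (h_Rq :: ('p, 'q) Rq)" for i
    using x_Rq_mult_h_Rq[where 'p = 'p and 'q = 'q] q_gt_1 q_card
    by (induction i) (simp_all add: mult.assoc)
  then have "h_Rq * h_Rq = (1 + (of_nat (card (residues_mod q)) + of_nat (card (nonresidues_mod q)))) * (h_Rq :: ('p, 'q) Rq)"
    by (subst (1) h_Rq_def)
      (simp add: j1_def j2_def distrib_right sum_distrib_right flip: q_card)
  also have "1 + (of_nat (card (residues_mod q)) + of_nat (card (nonresidues_mod q))) =
      (of_nat (1 + 2 * ((q - 1) div 2)) :: ('p, 'q) Rq)"
    using card_residues_mod[OF q] by simp
  also have "1 + 2 * ((q - 1) div 2) = q" using q(2) by presburger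
  also have "of_nat q = (scalar (of_nat q) :: ('p, 'q) Rq)"
    by (simp add: scalar.hom_of_nat)
  finally have hh: "h_Rq * h_Rq = scalar (of_nat q) * (h_Rq :: ('p, 'q) Rq)" .
  have "hq * hq = scalar (1 / of_nat q) * scalar (1 / of_nat q) * (h_Rq * h_Rq)"
    by (simp only: mult_ac)
  also have "\<dots> = scalar (1 / of_nat q * (1 / of_nat q * of_nat q)) * h_Rq"
    unfolding hh by (simp only: const_R_mult const_Rq_mult mult.assoc)
  finally show ?thesis using q_neq_0 by simp
qed

lemma sum_tilde: "e1_tilde \<theta> + e2_tilde \<theta> = 1 - hq"
proof -
  let ?A = "1/2 * (1 - 1/of_nat q) :: 'p mod_ring" and ?B = "1/2 * (1/of_nat q + 1/\<theta>)"
    and ?C = "1/2 * (1/of_nat q - 1/\<theta>)"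
  have half: "1/2 * z + 1/2 * z = z" for z :: "'p mod_ring"
    using two_neq_0 by (simp add: field_simps)
  have "?B + ?C = 1/2 * (1/of_nat q) + 1/2 * (1/of_nat q)"
    by (simp only: distrib_left right_diff_distrib) simp
  then have AA: "?A + ?A = 1 - 1/of_nat q" and BC: "?B + ?C = 1/of_nat q"
    using half by (simp_all only:)
  have "e1_tilde \<theta> + e2_tilde \<theta> =
      scalar (?A + ?A) - scalar (?B + ?C) * j1 - scalar (?B + ?C) * (j2 :: ('p, 'q) Rq)"
    unfolding e1_tilde_def e2_tilde_def Let_def q_card[symmetric] scalar_ring(1)[of ?A ?A]
      scalar_ring(1)[of ?B ?C]
    by (simp only: distrib_right) simp
  also have "\<dots> = 1 - hq"
    unfolding AA BC h_Rq_def scalar_ring(2) by (simp add: algebra_simps)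
  finally show ?thesis .
qed

lemma e_eq_tilde:
  "e1 \<theta> = e1_tilde \<theta> + hq" "e2 \<theta> = e2_tilde \<theta> + hq"
proof -
  have half: "1/2 * z + 1/2 * z = z" for z :: "'p mod_ring"
    using two_neq_0 by (simp add: field_simps)
  define v :: "'p mod_ring" where "v = 1 / of_nat q"
  define w where "w = 1 / \<theta>"
  have 1: "1/2 * (1 + v) = 1/2 * (1 - v) + v"
    and 2: "1/2 * (v - w) = v - 1/2 * (v + w)"
    and 3: "1/2 * (v + w) = v - 1/2 * (v - w)"
    using half[of v] by (simp_all only: distrib_left right_diff_distrib) (simp_all add: algebra_simps)
  show "e1 \<theta> = e1_tilde \<theta> + hq" "e2 \<theta> = e2_tilde \<theta> + hq"
    unfolding e1_def e2_def e1_tilde_def e2_tilde_def Let_def q_card[symmetric] v_def[symmetric]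
      w_def[symmetric] h_Rq_def
    by (subst 1, subst 2, subst (2) 3, simp only: scalar_ring, simp add: algebra_simps)+
qed

lemma power_subst_j:
  assumes "Legendre (int k) (int q) = -1"
  shows "power_subst k j1 = (j2 :: ('p, 'q) Rq)" "power_subst k j2 = (j1 :: ('p, 'q) Rq)"
  using sum_nonresidues_mult[OF q _ assms, of "x_Rq :: ('p, 'q) Rq"] x_Rq_power_card[where 'p = 'p and 'q = 'q]
  by (simp_all add: j1_def j2_def power_subst_sum power_subst_power q_card flip: power_mult)

lemma power_subst_tilde:
  assumes "Legendre (int k) (int q) = -1"
  shows "power_subst k (e1_tilde \<theta>) = (e2_tilde \<theta> :: ('p, 'q) Rq)"
    and "power_subst k (e2_tilde \<theta>) = (e1_tilde \<theta> :: ('p, 'q) Rq)"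
    and "power_subst k hq = hq"
  using power_subst_j[OF assms]
  by (simp_all add: e1_tilde_def e2_tilde_def h_Rq_def Let_def power_subst_add power_subst_diff
      power_subst_mult add_ac)

lemma tilde_orthogonal:
  "e1_tilde \<theta> * hq = 0" "e2_tilde \<theta> * hq = 0" "e1_tilde \<theta> * e2_tilde \<theta> = (0 :: ('p, 'q) Rq)"
  "e2_tilde \<theta> * e2_tilde \<theta> = (e2_tilde \<theta> :: ('p, 'q) Rq)"
proof -
  show 1: "e1_tilde \<theta> * hq = 0"
    by (simp only: mult.left_commute[of _ "scalar _"] e1_tilde_h mult_zero_right)
  have e2: "e2_tilde \<theta> = 1 - hq - e1_tilde \<theta>"
    using sum_tilde by (simp add: algebra_simps)
  show "e2_tilde \<theta> * hq = 0"
    unfolding e2 left_diff_distrib h_idem 1 by simp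
  show 12: "e1_tilde \<theta> * e2_tilde \<theta> = (0 :: ('p, 'q) Rq)"
    unfolding e2 right_diff_distrib 1 e1_tilde_idem by simp
  \<comment> \<open>Idempotency is carried over from \<open>e1_tilde\<close> by the endomorphism
    that exchanges the two.\<close>
  obtain k where "Legendre (int k) (int q) = -1" by (rule nonresidue_exists[OF q])
  from power_subst_tilde(1)[OF this]
  show "e2_tilde \<theta> * e2_tilde \<theta> = (e2_tilde \<theta> :: ('p, 'q) Rq)"
    by (metis e1_tilde_idem power_subst_mult)
qed

lemma card_ideal_gen_hq: "card (ideal_gen hq) = CARD('p) ^ 4"
proof (rule card_ideal_gen_h[OF x_h])
  fix r assume "const_Rq r * hq = 0"
  then have "scalar (of_nat q) * (const_Rq r * hq) = 0" by simp
  also have "scalar (of_nat q) * (const_Rq r * hq) =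
      scalar (of_nat q * (1 / of_nat q)) * (const_Rq r * h_Rq)"
    by (simp only: const_R_mult const_Rq_mult mult_ac)
  finally have "const_Rq r * (h_Rq :: ('p, 'q) Rq) = 0" using q_neq_0 by simp
  moreover have h: "h_Rq = (\<Sum>i<q. x_Rq ^ i :: ('p, 'q) Rq)"
    unfolding sum_split by (simp add: h_Rq_def j1_def j2_def flip: q_card)
  \<comment> \<open>\<open>h_Rq\<close> is the all-one word, so uniqueness of coordinates forces
    \<open>r = 0\<close>.\<close>
  have "word_Rq (\<lambda>_. r) = const_Rq r * (h_Rq :: ('p, 'q) Rq)"
    unfolding h word_Rq_def sum_distrib_left q_card ..
  moreover have "word_Rq (\<lambda>_. 0) = (0 :: ('p, 'q) Rq)" by (simp add: word_Rq_def)
  ultimately have "word_Rq (\<lambda>_. r) = (word_Rq (\<lambda>_. 0) :: ('p, 'q) Rq)" by simp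
  then show "r = 0" using word_Rq_inj[of "\<lambda>_. r" "\<lambda>_. 0" 0] by simp
qed

text \<open>Everything claimed for one pair of partner codes, stated for an arbitrary idempotent
  \<open>r\<close> so that the numbering of the codes enters only at the end.\<close>

lemma idempotent_code_properties:
  fixes r :: "'p R"
  assumes "r * r = r"
  defines "a \<equiv> (1 - const_Rq r) * e1_tilde \<theta> + const_Rq r * e2_tilde \<theta> :: ('p, 'q) Rq"
    and "b \<equiv> (1 - const_Rq (1 - r)) * e1_tilde \<theta> + const_Rq (1 - r) * e2_tilde \<theta> :: ('p, 'q) Rq"
  shows "code_equiv (ideal_gen (a + hq)) (ideal_gen (b + hq))"
    and "code_equiv (ideal_gen a) (ideal_gen b)"
    and "ideal_gen (a + hq) \<inter> ideal_gen (b + hq) = ideal_gen hq"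
    and "ideal_gen (a + hq) + ideal_gen (b + hq) = UNIV"
    and "ideal_gen a \<inter> ideal_gen b = {0}"
    and "ideal_gen a + ideal_gen b = ideal_gen (1 - hq)"
    and "ideal_gen a \<inter> ideal_gen hq = {0}"
    and "ideal_gen a + ideal_gen hq = ideal_gen (a + hq)"
    and "card (ideal_gen (a + hq)) = CARD('p) ^ (2 * (q + 1))"
    and "card (ideal_gen a) = CARD('p) ^ (2 * (q - 1))"
proof -
  have "const_Rq r * const_Rq r = (const_Rq r :: ('p, 'q) Rq)"
    using assms(1) by (simp flip: const_Rq_mult)
  note mixtures = complementary_mixtures[OF this e1_tilde_idem tilde_orthogonal(4,3,1,2)]
  have b: "b = (1 - (1 - const_Rq r)) * e1_tilde \<theta> + (1 - const_Rq r) * e2_tilde \<theta>"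
    unfolding b_def by (simp add: const_Rq_diff)
  have ab: "a * a = a" "b * b = b" "a * b = 0" "a * hq = 0" "b * hq = 0"
    unfolding a_def b by (rule mixtures)+
  have "a + b = e1_tilde \<theta> + e2_tilde \<theta>"
    unfolding a_def b by (rule mixtures)
  then have sum: "a + b + hq = 1" by (simp add: sum_tilde)
  note compl = complementary_ideals[OF ab(1,2) h_idem ab(3-5) sum]
  show "ideal_gen (a + hq) \<inter> ideal_gen (b + hq) = ideal_gen hq"
    "ideal_gen (a + hq) + ideal_gen (b + hq) = UNIV"
    "ideal_gen a \<inter> ideal_gen b = {0}"
    "ideal_gen a + ideal_gen b = ideal_gen (1 - hq)"
    "ideal_gen a \<inter> ideal_gen hq = {0}"
    "ideal_gen a + ideal_gen hq = ideal_gen (a + hq)"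
    by (rule compl)+
  obtain n where n: "Legendre (int n) (int q) = -1" by (rule nonresidue_exists[OF q])
  then have "\<not> q dvd n" by (simp flip: Legendre_eq_0_iff)
  then have "coprime n q"
    using q(1) prime_imp_coprime[of q n] by (simp add: coprime_commute)
  then obtain m where "[n * m = 1] (mod q)"
    using coprime_iff_invertible_nat[of n q] by auto
  then have mn: "[m * n = 1] (mod CARD('q))" by (simp add: mult.commute q_card)
  \<comment> \<open>A nonresidue exponent swaps the tilde elements and fixes \<open>hq\<close>,
    which turns the coefficient \<open>r\<close> into \<open>1 - r\<close>.\<close>
  have subst: "power_subst n a = b" "power_subst n (a + hq) = b + hq"
    using power_subst_tilde[OF n]
    by (simp_all add: a_def b_def power_subst_add power_subst_diff power_subst_mult const_Rq_diff
        add.commute)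
  show "code_equiv (ideal_gen (a + hq)) (ideal_gen (b + hq))"
    "code_equiv (ideal_gen a) (ideal_gen b)"
    using code_equiv_power_subst[OF mn, of "ideal_gen a"]
      code_equiv_power_subst[OF mn, of "ideal_gen (a + hq)"]
    unfolding power_subst_ideal_gen[OF mn] subst by simp_all
  have "inj (power_subst n :: ('p, 'q) Rq \<Rightarrow> _)"
    by (rule inj_on_inverseI) (rule power_subst_inverse[OF mn])
  then have "card (power_subst n ` ideal_gen a) = card (ideal_gen a)"
    by (intro card_image) (rule inj_on_subset, auto)
  then have eq: "card (ideal_gen b) = card (ideal_gen a)"
    by (simp add: power_subst_ideal_gen[OF mn] subst)
  have "(a + b) * (a + b) = a + b" "(a + b) * hq = 0"
    using ab by (simp_all add: distrib_left distrib_right mult.commute[of b a])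
  then have "card (ideal_gen (a + b + hq)) = card (ideal_gen a) * card (ideal_gen b) * card (ideal_gen hq)"
    using ab h_idem by (simp add: card_ideal_gen_sum)
  \<comment> \<open>The whole ring is the direct sum of three ideals, and the first two are in
    bijection.\<close>
  then have "CARD('p) ^ (4 * q) = card (ideal_gen a) ^ 2 * CARD('p) ^ 4"
    unfolding sum ideal_gen_1 card_Rq eq card_ideal_gen_hq q_card[symmetric]
    by (simp add: power2_eq_square)
  moreover have "4 * q = 2 * (q - 1) * 2 + 4" using q_gt_1 by simp
  ultimately have "(CARD('p) ^ (2 * (q - 1))) ^ 2 = card (ideal_gen a) ^ 2"
    by (simp only: power_add power_mult) simp
  then show card: "card (ideal_gen a) = CARD('p) ^ (2 * (q - 1))"
    by (simp add: power_eq_iff_eq_base)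
  have "card (ideal_gen (a + hq)) = CARD('p) ^ (2 * (q - 1) + 4)"
    using ab h_idem by (simp add: card_ideal_gen_sum card card_ideal_gen_hq power_add)
  also have "2 * (q - 1) + 4 = 2 * (q + 1)" using q_gt_1 by simp
  finally show "card (ideal_gen (a + hq)) = CARD('p) ^ (2 * (q + 1))" .
qed

end

end

theorem theorem8:
  fixes p q :: nat
    and \<xi> :: "'p::prime_card mod_ring"
    and \<alpha> :: "'p mod_ring alg_closure"
    and Q S :: "nat \<Rightarrow> ('p, 'q::finite) Rq set"
    and h' :: "('p, 'q) Rq"
  assumes p: "p = CARD('p)" "Factorial_Ring.prime p" "[p = 1] (mod 3)"
    and q: "q = CARD('q)" "Factorial_Ring.prime q" "odd q"
    and residue: "Legendre (int p) (int q) = 1"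
    and \<xi>: "primitive_root_of_unity 3 \<xi>"
    and \<alpha>: "primitive_root_of_unity q \<alpha>"
  defines "Q \<equiv> Q_code \<xi> \<alpha>" and "S \<equiv> S_code \<xi> \<alpha>"
    and "h' \<equiv> scalar (1 / of_nat q) * h_Rq"
  shows "(\<forall>i\<in>{1..4}. code_equiv (Q i) (Q (i + 4)) \<and> code_equiv (S i) (S (i + 4))) \<and>
    (\<forall>j\<in>{9..11}. code_equiv (Q j) (Q (j + 3)) \<and> code_equiv (S j) (S (j + 3))) \<and>
    (\<forall>i\<in>{1..4}.
      Q i \<inter> Q (i + 4) = ideal_gen h' \<and> Q i + Q (i + 4) = UNIV \<and>
      S i \<inter> S (i + 4) = {0} \<and> S i + S (i + 4) = ideal_gen (1 - h')) \<and>
    (\<forall>k\<in>{9..11}.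
      Q k \<inter> Q (k + 3) = ideal_gen h' \<and> Q k + Q (k + 3) = UNIV \<and>
      S k \<inter> S (k + 3) = {0} \<and> S k + S (k + 3) = ideal_gen (1 - h')) \<and>
    (\<forall>i\<in>{1..14}. S i \<inter> ideal_gen h' = {0} \<and> S i + ideal_gen h' = Q i) \<and>
    (\<forall>i\<in>{1..14}. card (Q i) = p ^ (2 * (q + 1)) \<and> card (S i) = p ^ (2 * (q - 1)))"
proof -
  \<comment> \<open>This makes 2 and 3 invertible, as the halves in the idempotents and the thirds
    in the etas require.\<close>
  have "CARD('p) \<noteq> 2" "CARD('p) \<noteq> 3"
    using p(1,3) by (auto simp: cong_def)
  then interpret quadratic_residue_root q \<alpha>
    using q residue p(1) \<alpha> by unfold_locales simp_all
  note q_card = \<open>q = CARD('q)\<close>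
  have three: "(3 :: 'p mod_ring) \<noteq> 0"
  proof
    assume "(3 :: 'p mod_ring) = 0"
    then have "CARD('p) dvd 3" using of_nat_0_mod_ring_dvd[of 3, where 'a = 'p] by simp
    then show False
      using \<open>CARD('p) \<noteq> 3\<close> prime_card[where 'a = 'p] primes_dvd_imp_eq[of "CARD('p)" 3] by simp
  qed
  have "\<xi> ^ 3 = 1" using \<xi> by (simp add: primitive_root_of_unity_def)
  note idem = code_coeff_idempotent[OF this three]
  note props = idempotent_code_properties[OF q_card idem, folded h'_def]
  define a :: "'p R \<Rightarrow> ('p, 'q) Rq"
    where "a r = (1 - const_Rq r) * e1_tilde \<theta> + const_Rq r * e2_tilde \<theta>" for r
  note props = props[folded a_def]
  have S: "S k = ideal_gen (a (code_coeff \<xi> k))" if "k \<in> {1..14}" for k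
    unfolding S_def S_code_def Let_def q_card[symmetric] \<theta>_def[symmetric] a_def
    by (simp only: code_generator_eq[OF that])
  have Q: "Q k = ideal_gen (a (code_coeff \<xi> k) + h')" if "k \<in> {1..14}" for k
  proof -
    \<comment> \<open>The weights add up to 1, so adding \<open>h'\<close> to both elements adds it
      once to the mixture.\<close>
    have "(1 - c) * (e1_tilde \<theta> + h') + c * (e2_tilde \<theta> + h') =
        (1 - c) * e1_tilde \<theta> + c * e2_tilde \<theta> + h'" for c
      by (simp add: algebra_simps)
    then show ?thesis
      unfolding Q_def Q_code_def Let_def q_card[symmetric] \<theta>_def[symmetric] a_def
      by (simp only: code_generator_eq[OF that] e_eq_tilde[OF q_card, folded h'_def])
  qed
  have mem: "k \<in> {1..14}" "k + 4 \<in> {1..14}" if "k \<in> {1..4}" for k :: nat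
    using that by auto
  have mem': "k \<in> {1..14}" "k + 3 \<in> {1..14}" if "k \<in> {9..11}" for k :: nat
    using that by auto
  show ?thesis
    \<comment> \<open>\<open>code_coeff_partner\<close> rewrites the partner's coefficient to
      \<open>1 - code_coeff \<xi> k\<close>, the form in which \<open>props\<close> speaks of
      pairs.\<close>
    by (intro conjI ballI; simp only: S Q mem mem' code_coeff_partner p(1) props)
qed

end
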